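(* Consider the model $y = X\beta + Rz$ and the finite collection of linear estimators $\hat\beta_m = \Psi_m y$, $m\in\mathcal{M}$, of $\beta$. Assume that $\mathcal{K}$ is a known real $p\times n$ matrix such that $\beta = \mathcal{K}X\beta$. Fix $\theta\in(0,1)$ and for all $m\in\mathcal{M}$ put $$A_m = R^T\big(-\theta\,\Psi_m^T\Psi_m + \mathcal{K}^T\Psi_m + \Psi_m^T\mathcal{K}\big)R,\qquad B_m = (\theta\Psi_m-\mathcal{K})\,R R^T\,(\theta\Psi_m-\mathcal{K})^T.$$ Let $s_m^+$ be the largest positive eigenvalue of the symmetric matrix $A_m$ (with $s_m^+=0$ if $A_m$ has no positive eigenvalue) and let $r_m^*$ be the largest singular value of $B_m$. Associate to each $m\in\mathcal{M}$ two positive real numbers $L_m$ and $h_m$, with $\Sigma := \sum_{m\in\mathcal{M}}\exp(-L_m)<\infty$, let $\lambda>0$, and put $$Q_m = 2\,\mathrm{tr}\big(R^T\mathcal{K}^T\Psi_m R\big) - \theta\|\Psi_m R\|^2 + 2\Big(\frac{r_m^*}{\theta}+s_m^+\Big)L_m + 2\|A_m\|\sqrt{L_m+h_m} + \lambda\Big(\frac{\|A_m\|}{\sqrt{L_m}+\sqrt{L_m+h_m}}+\frac{r_m^*}{\theta}+s_m^+\Big)^2 .$$ Then for every penalty function $\mathrm{pen}:\mathcal{M}\to\mathbb{R}$, the corresponding penalized estimator $\tilde\beta = \hat\beta_{\tilde m}$, where $\tilde m$ minimizes over $m\in\mathcal{M}$ the criterion $$\mathrm{Crit}(m) = y^T\big(\Psi_m^T\Psi_m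 - 2\mathcal{K}^T\Psi_m\big)y + \mathrm{pen}(m),$$ satisfies $$(1-\theta)\,\mathbb{E}\big[\|\tilde\beta-\beta\|^2\big] \le \inf_{m\in\mathcal{M}}\Big\{\|\beta\|^2 + \beta^TX^T\Psi_m^T\Psi_mX\beta - 2\beta^T\Psi_mX\beta + \|\Psi_mR\|^2 - 2\,\mathrm{tr}\big(R^T\mathcal{K}^T\Psi_mR\big) + \mathrm{pen}(m)\Big\} + \sup_{m\in\mathcal{M}}\big(Q_m-\mathrm{pen}(m)\big) + \frac{2\Sigma}{\lambda}.$$
   Context: Setting: $\beta\in\mathbb{R}^p$ is an unknown deterministic vector, $X$ is a known real $n\times p$ matrix (arbitrary $n,p$, arbitrary rank), $R$ is a known real $n\times n$ matrix, $z$ is an $n$-dimensional random vector with i.i.d. $N(0,1)$ components, and $y=X\beta+Rz$ is the observation. $\mathcal{M}$ is a finite nonempty index set, and for each $m\in\mathcal{M}$, $\Psi_m$ is a given deterministic real $p\times n$ matrix. For vectors, $\|\cdot\|$ is the Euclidean norm; for matrices, $\|\cdot\|$ is the Euclidean (Frobenius) norm, $\|A\|^2=\sum_{i,j}a_{ij}^2$. The penalty function is deterministic: it does not depend on the data $y$. $\tilde m$ is a (measurable) choice of minimizer of $\mathrm{Crit}$ over $\mathcal{M}$. *)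

theory Defs
  imports "HOL-Probability.Probability"
begin

text \<open>A real matrix with \<open>k\<close> rows and \<open>l\<close> columns has type \<open>real ^ 'l ^ 'k\<close>. On this type the
  library's \<open>norm\<close> is the Euclidean norm of the array of entries, i.e. the Frobenius norm.\<close>

definition eigenvalue :: "real ^ 'k ^ 'k \<Rightarrow> real \<Rightarrow> bool" where
  "eigenvalue A k \<longleftrightarrow> (\<exists>v. v \<noteq> 0 \<and> A *v v = k *\<^sub>R v)"

definition max_pos_eigenvalue :: "real ^ 'k ^ 'k \<Rightarrow> real" where
  "max_pos_eigenvalue A =
     (if \<exists>k > 0. eigenvalue A k then Max {k. 0 < k \<and> eigenvalue A k} else 0)"

definition max_singular_value :: "real ^ 'k ^ 'k \<Rightarrow> real" where
  "max_singular_value B = Max {sqrt k | k. eigenvalue (transpose B ** B) k}"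

definition iid_std_normal :: "'a measure \<Rightarrow> ('a \<Rightarrow> real ^ 'n) \<Rightarrow> bool" where
  "iid_std_normal P z \<longleftrightarrow>
     prob_space.indep_vars P (\<lambda>_. borel) (\<lambda>i \<omega>. z \<omega> $ i) UNIV \<and>
     (\<forall>i. distributed P lborel (\<lambda>\<omega>. z \<omega> $ i) std_normal_density)"

definition matA :: "real ^ 'n ^ 'n \<Rightarrow> real ^ 'n ^ 'p \<Rightarrow> real \<Rightarrow> real ^ 'n ^ 'p \<Rightarrow> real ^ 'n ^ 'n" where
  "matA R K \<theta> \<Psi> =
     transpose R ** (- (\<theta> *\<^sub>R (transpose \<Psi> ** \<Psi>)) + transpose K ** \<Psi> + transpose \<Psi> ** K) ** R"

definition matB :: "real ^ 'n ^ 'n \<Rightarrow> real ^ 'n ^ 'p \<Rightarrow> real \<Rightarrow> real ^ 'n ^ 'p \<Rightarrow> real ^ 'p ^ 'p" where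
  "matB R K \<theta> \<Psi> = (\<theta> *\<^sub>R \<Psi> - K) ** R ** transpose R ** transpose (\<theta> *\<^sub>R \<Psi> - K)"

definition Qterm ::
  "real ^ 'n ^ 'n \<Rightarrow> real ^ 'n ^ 'p \<Rightarrow> real \<Rightarrow> real \<Rightarrow> real ^ 'n ^ 'p \<Rightarrow> real \<Rightarrow> real \<Rightarrow> real" where
  "Qterm R K \<theta> lam \<Psi> L h =
     (let a = norm (matA R K \<theta> \<Psi>);
          s = max_pos_eigenvalue (matA R K \<theta> \<Psi>);
          r = max_singular_value (matB R K \<theta> \<Psi>)
      in 2 * trace (transpose R ** transpose K ** \<Psi> ** R) - \<theta> * (norm (\<Psi> ** R))\<^sup>2
         + 2 * (r / \<theta> + s) * L + 2 * a * sqrt (L + h)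
         + lam * (a / (sqrt L + sqrt (L + h)) + r / \<theta> + s)\<^sup>2)"

definition Crit ::
  "real ^ 'n ^ 'p \<Rightarrow> ('m \<Rightarrow> real ^ 'n ^ 'p) \<Rightarrow> ('m \<Rightarrow> real) \<Rightarrow> real ^ 'n \<Rightarrow> 'm \<Rightarrow> real" where
  "Crit K \<Psi> pen y m =
     y \<bullet> ((transpose (\<Psi> m) ** \<Psi> m - 2 *\<^sub>R (transpose K ** \<Psi> m)) *v y) + pen m"

end

theory Submission
  imports Defs
begin

text \<open>
  Write \<open>e\<^sub>m = \<Psi>\<^sub>m y - \<beta>\<close> and \<open>N = K R z\<close>. Since \<open>K y = \<beta> + N\<close>, the criterion is
  \<open>\<bar>e\<^sub>m\<bar>\<^sup>2 - 2 \<langle>N, e\<^sub>m\<rangle> + pen m\<close> up to a term not depending on \<open>m\<close>. Comparing the minimizer with a fixed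
  \<open>m\<close> leaves the fluctuation \<open>2 \<langle>N, e\<rangle> - \<theta> \<bar>e\<bar>\<^sup>2\<close> at the random index, which is bounded by
  \<open>Q\<close> plus the sum over all indices of the positive parts of the excesses over \<open>Q\<close>. For one
  index this fluctuation is \<open>\<langle>z, A z\<rangle> - 2 \<langle>b, z\<rangle> - \<theta> \<bar>g\<bar>\<^sup>2\<close> with \<open>\<bar>b\<bar>\<^sup>2 \<le> r \<bar>g\<bar>\<^sup>2\<close>. Diagonalizing
  \<open>A\<close> and using the rotation invariance of the Gaussian law, its exponential moments are explicit
  products, and \<open>max 0 x \<le> exp (t x) / (2 t)\<close> for a suitable \<open>t\<close> bounds the expected excess by
  \<open>exp (- L) / lam\<close>.
\<close>

section \<open>Diagonalization of real symmetric matrices\<close>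

lemma inner_transpose_matrix_vector:
  "(transpose M *v x) \<bullet> y = x \<bullet> (M *v y)" for M :: "real ^ 'n ^ 'm"
  by (simp add: dot_lmul_matrix)

text \<open>A maximizer of the Rayleigh quotient over the unit vectors orthogonal to
  \<open>B\<close> is such a vector. Symmetry makes the orthogonal complement of a set of
  eigenvectors invariant under \<open>A\<close>, and the first-order condition at the maximizer then
  forces the eigenvector equation.\<close>

lemma symmetric_eigenvector_in_orthogonal_complement:
  fixes A :: "real ^ 'n ^ 'n" and B :: "(real ^ 'n) set"
  assumes sym: "transpose A = A"
    and eig: "\<And>b. b \<in> B \<Longrightarrow> \<exists>k. A *v b = k *\<^sub>R b"
    and ne: "\<exists>x. x \<noteq> 0 \<and> (\<forall>b\<in>B. x \<bullet> b = 0)"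
  obtains v k where "norm v = 1" "\<And>b. b \<in> B \<Longrightarrow> v \<bullet> b = 0" "A *v v = k *\<^sub>R v"
proof -
  define S where "S = {x. \<forall>b\<in>B. x \<bullet> b = 0}"
  have self_adj: "x \<bullet> (A *v y) = (A *v x) \<bullet> y" for x y
    using inner_transpose_matrix_vector[of A x y] by (simp only: sym)
  have S_closed: "closed S"
  proof -
    have "S = (\<Inter>b\<in>B. {x. x \<bullet> b = 0})" by (auto simp: S_def)
    moreover have "closed {x. x \<bullet> b = 0}" for b :: "real ^ 'n"
      by (intro closed_Collect_eq continuous_intros)
    ultimately show ?thesis by auto
  qed
  have S_A: "A *v x \<in> S" if "x \<in> S" for x
  proof -
    have "(A *v x) \<bullet> b = 0" if b: "b \<in> B" for b
    proof -
      obtain k where "A *v b = k *\<^sub>R b" using eig[OF b] by blast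
      then show ?thesis using self_adj[of x b] \<open>x \<in> S\<close> b by (simp add: S_def)
    qed
    then show ?thesis by (simp add: S_def)
  qed
  have S_lin: "x + t *\<^sub>R y \<in> S" "t *\<^sub>R x \<in> S" if "x \<in> S" "y \<in> S" for x y t
    using that by (auto simp: S_def inner_add_left)
  let ?C = "sphere 0 1 \<inter> S"
  obtain x0 where x0: "x0 \<noteq> 0" "x0 \<in> S" using ne by (auto simp: S_def)
  then have "(1 / norm x0) *\<^sub>R x0 \<in> ?C" using S_lin(2) by simp
  then have ne: "?C \<noteq> {}" by blast
  have comp: "compact ?C" by (intro compact_Int_closed S_closed) auto
  have cont: "continuous_on ?C (\<lambda>x. x \<bullet> (A *v x))"
    by (intro continuous_intros linear_continuous_on) (simp add: linear_conv_bounded_linear[symmetric])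
  obtain v where v: "v \<in> ?C" and max: "\<And>x. x \<in> ?C \<Longrightarrow> x \<bullet> (A *v x) \<le> v \<bullet> (A *v v)"
    using continuous_attains_sup[OF comp ne cont] by blast
  define k where "k = v \<bullet> (A *v v)"
  have vv: "v \<bullet> v = 1" and vS: "v \<in> S" using v by (auto simp: dot_square_norm)
  have rayleigh: "x \<bullet> (A *v x) \<le> k * (x \<bullet> x)" if "x \<in> S" for x
  proof (cases "x = 0")
    case False
    have "(1 / norm x) *\<^sub>R x \<in> ?C" using S_lin(2) that False by simp
    from max[OF this] have "(x \<bullet> (A *v x)) / (norm x)\<^sup>2 \<le> k"
      by (simp add: k_def matrix_vector_mult_scaleR power2_eq_square)
    then show ?thesis using False by (simp add: field_simps dot_square_norm)
  qed simp
  have orth: "w \<bullet> (A *v v) = 0" if w: "w \<in> S" "w \<bullet> v = 0" for w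
  proof -
    let ?b = "w \<bullet> (A *v v)" and ?c = "k * (w \<bullet> w) - w \<bullet> (A *v w)"
    \<comment> \<open>This is \<open>rayleigh\<close> at the perturbation
      \<open>v + t *\<^sub>R w\<close>, where the terms of order zero cancel. A linear term
      dominated by a quadratic one for all \<open>t\<close> must vanish.\<close>
    have ineq: "2 * t * ?b \<le> t\<^sup>2 * ?c" for t
    proof -
      have "v \<bullet> (A *v w) = ?b" using self_adj[of v w] by (simp add: inner_commute)
      then have "(v + t *\<^sub>R w) \<bullet> (A *v (v + t *\<^sub>R w)) = k + 2 * t * ?b + t\<^sup>2 * (w \<bullet> (A *v w))"
        by (simp add: k_def matrix_vector_right_distrib matrix_vector_mult_scaleR inner_add
            power2_eq_square algebra_simps)
      moreover have "(v + t *\<^sub>R w) \<bullet> (v + t *\<^sub>R w) = 1 + t\<^sup>2 * (w \<bullet> w)"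
        using w(2) vv by (simp add: inner_add power2_eq_square inner_commute)
      ultimately show ?thesis
        using rayleigh[OF S_lin(1)[OF vS w(1), of t]] by (simp add: algebra_simps)
    qed
    have c0: "?c \<ge> 0" using rayleigh[OF w(1)] by simp
    \<comment> \<open>The choice \<open>t = ?b / (1 + ?c)\<close> stays meaningful when
      \<open>?c = 0\<close>.\<close>
    have "2 * ?b * ?b / (1 + ?c) \<le> ?b\<^sup>2 / (1 + ?c)\<^sup>2 * ?c"
      using ineq[of "?b / (1 + ?c)"] by (simp add: power_divide)
    also have "\<dots> \<le> ?b\<^sup>2 / (1 + ?c)"
    proof -
      have "?b\<^sup>2 / (1 + ?c)\<^sup>2 * ?c = ?b\<^sup>2 / (1 + ?c) * (?c / (1 + ?c))"
        by (simp add: power2_eq_square)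
      also have "\<dots> \<le> ?b\<^sup>2 / (1 + ?c) * 1"
        using c0 by (intro mult_left_mono) auto
      finally show ?thesis by simp
    qed
    finally have "2 * ?b\<^sup>2 \<le> ?b\<^sup>2"
      using c0 by (simp add: divide_le_cancel power2_eq_square)
    then show ?thesis by simp
  qed
  \<comment> \<open>The residual of the eigenvector equation lies in \<open>S\<close> and is
    orthogonal to \<open>v\<close>, so \<open>orth\<close> makes it orthogonal to
    \<open>A *v v\<close> as well, hence to itself.\<close>
  define w where "w = A *v v - k *\<^sub>R v"
  have wS: "w \<in> S" using S_lin(1)[OF S_A[OF vS] vS, of "-k"] by (simp add: w_def)
  have wv: "w \<bullet> v = 0" by (simp add: w_def inner_diff k_def vv inner_commute)
  have "w \<bullet> w = w \<bullet> (A *v v) - k * (w \<bullet> v)" by (simp add: w_def inner_diff_right)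
  also have "\<dots> = 0" using orth[OF wS wv] wv by simp
  finally have "A *v v = k *\<^sub>R v" by (simp add: w_def)
  then show thesis using that[of v k] vS v by (auto simp: S_def)
qed

text \<open>An orthonormal set of eigenvectors of maximal cardinality must span, since otherwise the
  previous lemma extends it. A maximum exists because orthonormal sets are linearly
  independent.\<close>

lemma symmetric_orthonormal_eigenbasis:
  fixes A :: "real ^ 'n ^ 'n"
  assumes sym: "transpose A = A"
  obtains B where "pairwise orthogonal B" "\<And>b. b \<in> B \<Longrightarrow> norm b = 1"
    "card B = CARD('n)" "\<And>b. b \<in> B \<Longrightarrow> \<exists>k. A *v b = k *\<^sub>R b"
proof -
  define Q where "Q B \<longleftrightarrow> pairwise orthogonal B \<and> (\<forall>b\<in>B. norm b = 1) \<and>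
    (\<forall>b\<in>B. \<exists>k. A *v b = k *\<^sub>R b)" for B
  have indep: "independent B" if "Q B" for B
    using that by (intro pairwise_orthogonal_independent) (auto simp: Q_def)
  have bound: "card B < Suc CARD('n)" if "Q B" for B
    using independent_bound[OF indep[OF that]] by simp
  have "Q {}" by (simp add: Q_def pairwise_def)
  then obtain B where B: "Q B" and max: "\<And>B'. Q B' \<Longrightarrow> card B' \<le> card B"
    using ex_has_greatest_nat[of Q "{}" card "Suc CARD('n)"] bound by (metis less_imp_le)
  have fin: "finite B" using independent_bound[OF indep[OF B]] by simp
  have "span B = UNIV"
  proof (rule ccontr)
    assume "span B \<noteq> UNIV"
    then have "span B \<subset> UNIV" by blast
    then obtain a where "a \<noteq> 0" "\<forall>x\<in>span B. a \<bullet> x = 0"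
      using span_not_UNIV_orthogonal[of B] by blast
    then have "\<exists>x. x \<noteq> 0 \<and> (\<forall>b\<in>B. x \<bullet> b = 0)" by (metis span_base)
    then obtain v k where v: "norm v = 1" "\<And>b. b \<in> B \<Longrightarrow> v \<bullet> b = 0" "A *v v = k *\<^sub>R v"
      using symmetric_eigenvector_in_orthogonal_complement[OF sym] B unfolding Q_def by metis
    have "v \<notin> B"
    proof
      assume "v \<in> B"
      then have "v \<bullet> v = 0" by (rule v(2))
      then show False using v(1) by simp
    qed
    have "pairwise orthogonal (insert v B)"
      using v(2) B by (intro pairwise_orthogonal_insert) (auto simp: Q_def orthogonal_def)
    then have "Q (insert v B)"
      using B v by (auto simp: Q_def)
    from max[OF this] show False using \<open>v \<notin> B\<close> fin by simp
  qed
  then have "card B = CARD('n)"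
    using indep[OF B] by (metis dim_eq_card_independent dim_UNIV dim_span DIM_cart DIM_real mult.right_neutral)
  then show thesis using B by (intro that[of B]) (auto simp: Q_def)
qed

section \<open>Diagonal form and the spectral quantities read off from it\<close>

definition diag_mat :: "('n \<Rightarrow> real) \<Rightarrow> real ^ 'n ^ 'n" where
  "diag_mat d = (\<chi> i j. if i = j then d i else 0)"

lemma diag_mat_mult_vec: "diag_mat d *v x = (\<chi> i. d i * x $ i)"
  by (simp add: diag_mat_def matrix_vector_mult_def vec_eq_iff if_distrib if_distribR cong: if_cong)

lemma transpose_diag_mat [simp]: "transpose (diag_mat d) = diag_mat d"
  by (auto simp: diag_mat_def transpose_def vec_eq_iff)

lemma diag_mat_mult: "diag_mat d ** diag_mat e = diag_mat (\<lambda>i. d i * e i)"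
proof -
  have "(diag_mat d ** diag_mat e) $ i $ j = diag_mat (\<lambda>i. d i * e i) $ i $ j" for i j
  proof -
    have "(diag_mat d ** diag_mat e) $ i $ j
        = (\<Sum>k\<in>UNIV. if k = i then d i * (if i = j then e i else 0) else 0)"
      unfolding matrix_matrix_mult_def vec_lambda_beta
      by (intro sum.cong) (auto simp: diag_mat_def)
    then show ?thesis by (simp add: diag_mat_def)
  qed
  then show ?thesis by (simp add: vec_eq_iff)
qed

lemma trace_diag_mat: "trace (diag_mat d) = (\<Sum>i\<in>UNIV. d i)"
  by (simp add: trace_def diag_mat_def)

lemma norm_matrix_sq: "(norm A)\<^sup>2 = trace (transpose A ** A)" for A :: "real ^ 'n ^ 'm"
proof -
  have "(norm A)\<^sup>2 = (\<Sum>i\<in>UNIV. \<Sum>j\<in>UNIV. A $ i $ j * A $ i $ j)"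
    by (simp add: power2_norm_eq_inner inner_vec_def)
  also have "\<dots> = (\<Sum>j\<in>UNIV. \<Sum>i\<in>UNIV. A $ i $ j * A $ i $ j)" by (rule sum.swap)
  also have "\<dots> = trace (transpose A ** A)"
    by (simp add: trace_def matrix_matrix_mult_def transpose_def)
  finally show ?thesis .
qed

text \<open>The columns of \<open>U\<close> are the orthonormal eigenvectors; as there are
  \<open>CARD('n)\<close> of them, a bijection numbers them by the index type itself.\<close>

lemma symmetric_diagonalization:
  fixes A :: "real ^ 'n ^ 'n"
  assumes sym: "transpose A = A"
  obtains U d where "orthogonal_matrix U" "A = U ** diag_mat d ** transpose U"
proof -
  obtain B where B: "pairwise orthogonal B" "\<And>b. b \<in> B \<Longrightarrow> norm b = 1"
    "card B = CARD('n)" "\<And>b. b \<in> B \<Longrightarrow> \<exists>k. A *v b = k *\<^sub>R b"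
    using symmetric_orthonormal_eigenbasis[OF sym] by metis
  have "finite B" using B(3) by (metis card.infinite card_0_eq finite UNIV_not_empty)
  then obtain f where f: "bij_betw f (UNIV :: 'n set) B"
    using B(3) finite_same_card_bij[of "UNIV :: 'n set" B] by auto
  then have fB: "f i \<in> B" for i by (auto simp: bij_betw_def)
  have "\<forall>i. \<exists>k. A *v f i = k *\<^sub>R f i" using B(4) fB by blast
  then obtain d where d: "\<And>i. A *v f i = d i *\<^sub>R f i" by metis
  define U :: "real ^ 'n ^ 'n" where "U = (\<chi> i j. f j $ i)"
  have col: "column j U = f j" for j by (simp add: U_def column_def)
  have "orthogonal (f i) (f j)" if "i \<noteq> j" for i j
    using B(1) fB that f by (metis pairwiseD bij_betw_def inj_eq)
  then have U: "orthogonal_matrix U"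
    unfolding orthogonal_matrix_orthonormal_columns using B(2) fB by (simp add: col)
  have "(A ** U) $ i $ j = (U ** diag_mat d) $ i $ j" for i j
  proof -
    have "(A ** U) $ i $ j = (A *v f j) $ i"
      by (simp add: matrix_matrix_mult_def matrix_vector_mult_def U_def)
    also have "\<dots> = (U ** diag_mat d) $ i $ j"
      by (simp add: d matrix_matrix_mult_def U_def diag_mat_def if_distrib if_distribR mult.commute cong: if_cong)
    finally show ?thesis .
  qed
  then have "A ** U = U ** diag_mat d" by (simp add: vec_eq_iff)
  then have "A = U ** diag_mat d ** transpose U"
    using U by (metis matrix_mul_assoc matrix_mul_rid orthogonal_matrix_def)
  with U show thesis by (rule that)
qed

text \<open>Everything is computed in the coordinates \<open>transpose U *v x\<close>: the trace by
  cyclicity, the norm as the trace of \<open>A ** A\<close> since \<open>A\<close> is symmetric, and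
  the eigenvalues because \<open>U\<close> carries eigenvectors of \<open>diag_mat d\<close> to
  eigenvectors of \<open>A\<close>.\<close>

lemma
  fixes U :: "real ^ 'n ^ 'n"
  assumes U: "orthogonal_matrix U" and A: "A = U ** diag_mat d ** transpose U"
  shows quadratic_form_diagonalized: "x \<bullet> (A *v x) = (\<Sum>i\<in>UNIV. d i * ((transpose U *v x) $ i)\<^sup>2)"
    and trace_diagonalized: "trace A = (\<Sum>i\<in>UNIV. d i)"
    and norm_diagonalized: "(norm A)\<^sup>2 = (\<Sum>i\<in>UNIV. (d i)\<^sup>2)"
    and eigenvalues_diagonalized: "{k. eigenvalue A k} = range d"
proof -
  have UU: "transpose U ** U = mat 1" "U ** transpose U = mat 1"
    using U by (auto simp: orthogonal_matrix_def)
  have "x \<bullet> (A *v x) = (transpose U *v x) \<bullet> (diag_mat d *v (transpose U *v x))"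
    unfolding A inner_transpose_matrix_vector by (simp only: matrix_vector_mul_assoc matrix_mul_assoc)
  then show "x \<bullet> (A *v x) = (\<Sum>i\<in>UNIV. d i * ((transpose U *v x) $ i)\<^sup>2)"
    by (simp add: inner_vec_def diag_mat_mult_vec power2_eq_square mult_ac)
  have conj_trace: "trace (U ** D ** transpose U) = trace D" for D
    by (simp only: trace_mul_sym[of "U ** D"] matrix_mul_assoc UU matrix_mul_lid)
  show "trace A = (\<Sum>i\<in>UNIV. d i)" by (simp add: A conj_trace trace_diag_mat)
  have "transpose A = A"
    by (simp add: A matrix_transpose_mul matrix_mul_assoc)
  then have "(norm A)\<^sup>2 = trace (A ** A)" by (simp add: norm_matrix_sq)
  also have "A ** A = U ** (diag_mat d ** (transpose U ** U) ** diag_mat d) ** transpose U"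
    unfolding A by (simp only: matrix_mul_assoc)
  also have "trace \<dots> = (\<Sum>i\<in>UNIV. (d i)\<^sup>2)"
    by (simp add: UU conj_trace diag_mat_mult trace_diag_mat power2_eq_square)
  finally show "(norm A)\<^sup>2 = (\<Sum>i\<in>UNIV. (d i)\<^sup>2)" .
  have "k \<in> range d" if eig: "eigenvalue A k" for k
  proof -
    obtain v where v: "v \<noteq> 0" "A *v v = k *\<^sub>R v" using eig by (auto simp: eigenvalue_def)
    define w where "w = transpose U *v v"
    have "U *v w = v"
      unfolding w_def by (simp only: matrix_vector_mul_assoc UU matrix_vector_mul_lid)
    then obtain i where i: "w $ i \<noteq> 0" using v(1) by (metis matrix_vector_mult_0_right vec_eq_iff zero_index)
    have "diag_mat d *v w = transpose U *v (A *v v)"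
      unfolding A w_def
      by (simp only: matrix_vector_mul_assoc matrix_mul_assoc UU matrix_mul_lid)
    also have "\<dots> = k *\<^sub>R w" by (simp only: v w_def matrix_vector_mult_scaleR)
    finally have "d i * w $ i = k * w $ i" by (simp add: diag_mat_mult_vec vec_eq_iff)
    with i show ?thesis by auto
  qed
  moreover have "eigenvalue A (d i)" for i
  proof -
    have "A *v (U *v axis i 1) = U *v (diag_mat d *v axis i 1)"
      unfolding A by (simp only: matrix_vector_mul_assoc matrix_mul_assoc[symmetric] UU matrix_mul_rid)
    also have "diag_mat d *v axis i 1 = d i *\<^sub>R axis i 1"
      by (auto simp: diag_mat_mult_vec vec_eq_iff axis_def)
    finally have *: "A *v (U *v axis i 1) = d i *\<^sub>R (U *v axis i 1)"
      by (simp add: matrix_vector_mult_scaleR)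
    have "transpose U *v (U *v axis i 1) \<noteq> 0"
      by (simp only: matrix_vector_mul_assoc UU matrix_vector_mul_lid) (simp add: axis_eq_0_iff)
    then have "U *v axis i 1 \<noteq> 0" by (metis matrix_vector_mult_0_right)
    with * show ?thesis by (auto simp: eigenvalue_def)
  qed
  ultimately show "{k. eigenvalue A k} = range d" by auto
qed

text \<open>The third claim serves the case where all \<open>d i\<close> vanish: it then yields the
  value \<open>0\<close>.\<close>

lemma max_pos_eigenvalue_diagonalized:
  fixes U :: "real ^ 'n ^ 'n"
  assumes U: "orthogonal_matrix U" and A: "A = U ** diag_mat d ** transpose U"
  shows "d i \<le> max_pos_eigenvalue A" and "0 \<le> max_pos_eigenvalue A"
    and "max_pos_eigenvalue A = 0 \<or> max_pos_eigenvalue A \<in> range d"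
proof -
  have E: "eigenvalue A k \<longleftrightarrow> k \<in> range d" for k
    using eigenvalues_diagonalized[OF U A] by auto
  let ?S = "{k. 0 < k \<and> eigenvalue A k}"
  have fin: "finite ?S" by (simp add: E)
  have *: "(\<exists>k>0. eigenvalue A k) \<longleftrightarrow> ?S \<noteq> {}" by auto
  have "?S \<noteq> {} \<Longrightarrow> Max ?S \<in> ?S" using fin by (rule Max_in)
  then show "0 \<le> max_pos_eigenvalue A" "max_pos_eigenvalue A = 0 \<or> max_pos_eigenvalue A \<in> range d"
    unfolding max_pos_eigenvalue_def * by (auto simp: E less_imp_le)
  show "d i \<le> max_pos_eigenvalue A"
  proof (cases "0 < d i")
    case True
    then have "d i \<in> ?S" by (simp add: E)
    then have "d i \<le> Max ?S" and "?S \<noteq> {}" using fin by (auto intro: Max_ge)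
    then show ?thesis unfolding max_pos_eigenvalue_def * by simp
  next
    case False
    with \<open>0 \<le> max_pos_eigenvalue A\<close> show ?thesis by linarith
  qed
qed

text \<open>Applied later with \<open>C = (\<theta> *\<^sub>R \<Psi> - K) ** R\<close>, for which
  \<open>C ** transpose C\<close> is \<open>matB\<close>. The squared norm is the quadratic form of
  this Gram matrix, and the singular values of a symmetric matrix are the absolute values of its
  eigenvalues.\<close>

lemma max_singular_value_gram:
  fixes C :: "real ^ 'n ^ 'p"
  shows "0 \<le> max_singular_value (C ** transpose C)"
    and "(norm (transpose C *v g))\<^sup>2 \<le> max_singular_value (C ** transpose C) * (norm g)\<^sup>2"
proof -
  define B where "B = C ** transpose C"
  have symB: "transpose B = B" by (simp add: B_def matrix_transpose_mul)
  obtain U d where U: "orthogonal_matrix U" and B: "B = U ** diag_mat d ** transpose U"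
    using symmetric_diagonalization[OF symB] by metis
  have UU: "transpose U ** U = mat 1" "U ** transpose U = mat 1"
    using U by (auto simp: orthogonal_matrix_def)
  have "transpose B ** B = U ** (diag_mat d ** (transpose U ** U) ** diag_mat d) ** transpose U"
    unfolding symB unfolding B by (simp only: matrix_mul_assoc)
  then have BB: "transpose B ** B = U ** diag_mat (\<lambda>i. (d i)\<^sup>2) ** transpose U"
    by (simp add: UU diag_mat_mult power2_eq_square)
  have "{sqrt k | k. eigenvalue (transpose B ** B) k} = sqrt ` {k. eigenvalue (transpose B ** B) k}"
    by auto
  also have "\<dots> = range (\<lambda>i. \<bar>d i\<bar>)"
    by (simp add: eigenvalues_diagonalized[OF U BB] image_image)
  finally have r: "max_singular_value B = Max (range (\<lambda>i. \<bar>d i\<bar>))"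
    by (simp add: max_singular_value_def)
  have d_le: "\<bar>d i\<bar> \<le> max_singular_value B" for i
    unfolding r by (intro Max_ge) auto
  show "0 \<le> max_singular_value (C ** transpose C)"
    using d_le unfolding B_def by (metis abs_ge_zero order_trans)
  have "(norm (transpose C *v g))\<^sup>2 = g \<bullet> (B *v g)"
    unfolding B_def power2_norm_eq_inner inner_transpose_matrix_vector
    by (simp only: matrix_vector_mul_assoc)
  also have "\<dots> = (\<Sum>i\<in>UNIV. d i * ((transpose U *v g) $ i)\<^sup>2)"
    by (rule quadratic_form_diagonalized[OF U B])
  also have "\<dots> \<le> (\<Sum>i\<in>UNIV. max_singular_value B * ((transpose U *v g) $ i)\<^sup>2)"
    using d_le by (intro sum_mono mult_right_mono) (auto simp: abs_le_iff)
  also have "\<dots> = max_singular_value B * ((transpose U *v g) \<bullet> (transpose U *v g))"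
    by (simp add: inner_vec_def power2_eq_square sum_distrib_left)
  also have "(transpose U *v g) \<bullet> (transpose U *v g) = (norm g)\<^sup>2"
    unfolding power2_norm_eq_inner inner_transpose_matrix_vector
    by (simp only: matrix_vector_mul_assoc UU matrix_vector_mul_lid)
  finally show "(norm (transpose C *v g))\<^sup>2 \<le> max_singular_value (C ** transpose C) * (norm g)\<^sup>2"
    by (simp add: B_def)
qed

section \<open>Gaussian vectors\<close>

text \<open>Completing the square turns the integrand into a constant times the normal density with
  mean \<open>q / (1 - 2 * p)\<close> and variance \<open>1 / (1 - 2 * p)\<close>.\<close>

lemma gaussian_exp_quadratic_1d:
  fixes p q :: real
  assumes p: "2 * p < 1"
  shows "(\<integral>\<^sup>+x. ennreal (std_normal_density x * exp (p * x\<^sup>2 + q * x)) \<partial>lborel)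
    = ennreal (exp (q\<^sup>2 / (2 * (1 - 2 * p))) / sqrt (1 - 2 * p))"
proof -
  define \<tau> where "\<tau> = 1 - 2 * p"
  define C where "C = exp (q\<^sup>2 / (2 * \<tau>)) / sqrt \<tau>"
  have \<tau>: "\<tau> > 0" using p by (simp add: \<tau>_def)
  have C: "C \<ge> 0" using \<tau> by (simp add: C_def)
  have "std_normal_density x * exp (p * x\<^sup>2 + q * x) = C * normal_density (q / \<tau>) (1 / sqrt \<tau>) x" for x
  proof -
    have p_eq: "p = (1 - \<tau>) / 2" by (simp add: \<tau>_def)
    have "- x\<^sup>2 / 2 + (p * x\<^sup>2 + q * x) = q\<^sup>2 / (2 * \<tau>) + - (x - q / \<tau>)\<^sup>2 / (2 * (1 / sqrt \<tau>)\<^sup>2)"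
      using \<tau> by (simp add: p_eq power_divide field_simps power2_eq_square)
    then have "exp (- x\<^sup>2 / 2) * exp (p * x\<^sup>2 + q * x)
        = exp (q\<^sup>2 / (2 * \<tau>)) * exp (- (x - q / \<tau>)\<^sup>2 / (2 * (1 / sqrt \<tau>)\<^sup>2))"
      by (simp only: exp_add[symmetric])
    moreover have "1 / sqrt (2 * pi) = 1 / sqrt \<tau> * (1 / sqrt (2 * pi * (1 / sqrt \<tau>)\<^sup>2))"
      using \<tau> by (simp add: power_divide real_sqrt_divide real_sqrt_mult)
    ultimately show ?thesis by (simp add: normal_density_def C_def)
  qed
  then have "(\<integral>\<^sup>+x. ennreal (std_normal_density x * exp (p * x\<^sup>2 + q * x)) \<partial>lborel)
      = (\<integral>\<^sup>+x. ennreal C * ennreal (normal_density (q / \<tau>) (1 / sqrt \<tau>) x) \<partial>lborel)"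
    using C by (simp add: ennreal_mult)
  also have "\<dots> = ennreal C * (\<integral>\<^sup>+x. ennreal (normal_density (q / \<tau>) (1 / sqrt \<tau>) x) \<partial>lborel)"
    by (rule nn_integral_cmult) simp
  also have "(\<integral>\<^sup>+x. ennreal (normal_density (q / \<tau>) (1 / sqrt \<tau>) x) \<partial>lborel) = 1"
    using \<tau> by (subst nn_integral_eq_integral) (auto simp: normal_density_nonneg)
  finally show ?thesis by (simp add: C_def \<tau>_def)
qed

section \<open>Product measures and the density of a standard normal vector\<close>

lemma measurable_vec_lambda_PiM:
  assumes "\<And>i. sets (N i) = sets (borel :: real measure)"
  shows "(\<lambda>f. \<chi> i. f i) \<in> measurable (Pi\<^sub>M (UNIV :: 'n::finite set) N) (borel :: (real ^ 'n) measure)"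
proof -
  have "(\<lambda>f. f i) \<in> borel_measurable (Pi\<^sub>M (UNIV :: 'n set) N)" for i
    using measurable_component_singleton[of i UNIV N] assms by (simp cong: measurable_cong_sets)
  then show ?thesis
    by (subst borel_measurable_euclidean_space) (auto simp: Basis_vec_def inner_axis)
qed

text \<open>Lebesgue measure is determined by its values on boxes, and the preimage of a box is a
  product of intervals. The equation carries product integrals on function spaces over to the vector
  type.\<close>

lemma lborel_vec_eq_distr_PiM:
  "(lborel :: (real ^ 'n) measure) = distr (Pi\<^sub>M UNIV (\<lambda>_. lborel)) borel (\<lambda>f. \<chi> i. f i)"
proof (rule lborel_eqI)
  interpret product_sigma_finite "\<lambda>_ :: 'n. lborel :: real measure" ..
  fix l u :: "real ^ 'n"
  assume le: "\<And>b. b \<in> Basis \<Longrightarrow> l \<bullet> b \<le> u \<bullet> b"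
  have le': "l $ i \<le> u $ i" for i
    using le[of "axis i 1"] by (auto simp: Basis_vec_def inner_axis)
  have inj: "inj (\<lambda>i :: 'n. axis i (1 :: real))" by (auto simp: inj_on_def axis_eq_axis)
  have "emeasure (distr (Pi\<^sub>M UNIV (\<lambda>_. lborel)) borel (\<lambda>f. \<chi> i. f i)) (box l u)
      = emeasure (Pi\<^sub>M UNIV (\<lambda>_. lborel)) ((\<lambda>f. \<chi> i. f i) -` box l u \<inter> space (Pi\<^sub>M UNIV (\<lambda>_. lborel)))"
    by (intro emeasure_distr measurable_vec_lambda_PiM) auto
  also have "(\<lambda>f. \<chi> i. f i) -` box l u \<inter> space (Pi\<^sub>M UNIV (\<lambda>_. lborel)) = Pi\<^sub>E UNIV (\<lambda>i. {l $ i<..<u $ i})"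
    by (auto simp: mem_box_cart space_PiM PiE_def Pi_def)
  also have "emeasure (Pi\<^sub>M UNIV (\<lambda>_. lborel)) \<dots> = (\<Prod>i\<in>UNIV. ennreal (u $ i - l $ i))"
    by (subst emeasure_PiM) (auto simp: le')
  also have "\<dots> = ennreal (\<Prod>i\<in>UNIV. (u - l) $ i)"
    by (subst prod_ennreal) (auto simp: le')
  also have "(\<Prod>i\<in>UNIV. (u - l) $ i) = (\<Prod>b\<in>range (\<lambda>i. axis i 1). (u - l) \<bullet> b)"
    by (subst prod.reindex[OF inj]) (simp add: inner_axis)
  also have "range (\<lambda>i. axis i 1) = (Basis :: (real ^ 'n) set)" by (auto simp: Basis_vec_def)
  finally show "emeasure (distr (Pi\<^sub>M UNIV (\<lambda>_. lborel)) borel (\<lambda>f. \<chi> i. f i)) (box l u)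
      = ennreal (\<Prod>b\<in>Basis. (u - l) \<bullet> b)" by simp
qed simp

lemma nn_integral_lborel_vec_prod:
  fixes f :: "'n::finite \<Rightarrow> real \<Rightarrow> ennreal"
  assumes [measurable]: "\<And>i. f i \<in> borel_measurable borel"
  shows "(\<integral>\<^sup>+x. (\<Prod>i\<in>UNIV. f i (x $ i)) \<partial>(lborel :: (real ^ 'n) measure)) = (\<Prod>i\<in>UNIV. \<integral>\<^sup>+t. f i t \<partial>lborel)"
proof -
  interpret product_sigma_finite "\<lambda>_ :: 'n. lborel :: real measure" ..
  have "(\<integral>\<^sup>+x. (\<Prod>i\<in>UNIV. f i (x $ i)) \<partial>(lborel :: (real ^ 'n) measure))
      = (\<integral>\<^sup>+x. (\<Prod>i\<in>UNIV. f i (x i)) \<partial>Pi\<^sub>M UNIV (\<lambda>_. lborel))"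
    by (subst lborel_vec_eq_distr_PiM, subst nn_integral_distr)
      (auto intro!: measurable_vec_lambda_PiM)
  also have "\<dots> = (\<Prod>i\<in>UNIV. \<integral>\<^sup>+t. f i t \<partial>lborel)"
    by (rule product_nn_integral_prod) auto
  finally show ?thesis .
qed

text \<open>It suffices to compare the two measures on rectangles, where the integral factors over
  the coordinates.\<close>

lemma PiM_density:
  fixes g :: "real \<Rightarrow> ennreal"
  assumes [measurable]: "g \<in> borel_measurable borel"
    and sf: "sigma_finite_measure (density lborel g)"
  shows "Pi\<^sub>M (UNIV :: 'n::finite set) (\<lambda>_. density lborel g)
    = density (Pi\<^sub>M UNIV (\<lambda>_. lborel)) (\<lambda>f. \<Prod>i\<in>UNIV. g (f i))"
proof -
  interpret L: product_sigma_finite "\<lambda>_ :: 'n. lborel :: real measure" ..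
  interpret D: sigma_finite_measure "density lborel g" by (rule sf)
  interpret D: product_sigma_finite "\<lambda>_ :: 'n. density lborel g" ..
  show ?thesis
  proof (rule D.PiM_eqI[symmetric])
    fix A :: "'n \<Rightarrow> real set"
    assume "\<And>i. i \<in> UNIV \<Longrightarrow> A i \<in> sets (density lborel g)"
    then have [measurable]: "A i \<in> sets borel" for i by auto
    have "emeasure (density (Pi\<^sub>M UNIV (\<lambda>_. lborel)) (\<lambda>f. \<Prod>i\<in>UNIV. g (f i))) (Pi\<^sub>E UNIV A)
        = (\<integral>\<^sup>+f. (\<Prod>i\<in>UNIV. g (f i)) * indicator (Pi\<^sub>E UNIV A) f \<partial>Pi\<^sub>M UNIV (\<lambda>_. lborel))"
      by (intro emeasure_density) (auto intro!: sets_PiM_I_finite)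
    also have "\<dots> = (\<integral>\<^sup>+f. (\<Prod>i\<in>UNIV. g (f i) * indicator (A i) (f i)) \<partial>Pi\<^sub>M UNIV (\<lambda>_. lborel))"
      by (intro nn_integral_cong) (auto simp: prod.distrib indicator_def PiE_def Pi_def)
    also have "\<dots> = (\<Prod>i\<in>UNIV. \<integral>\<^sup>+x. g x * indicator (A i) x \<partial>lborel)"
      by (rule L.product_nn_integral_prod) auto
    also have "\<dots> = (\<Prod>i\<in>UNIV. emeasure (density lborel g) (A i))"
      by (intro prod.cong) (auto simp: emeasure_density)
    finally show "emeasure (density (Pi\<^sub>M UNIV (\<lambda>_. lborel)) (\<lambda>f. \<Prod>i\<in>UNIV. g (f i))) (Pi\<^sub>E UNIV A)
        = (\<Prod>i\<in>UNIV. emeasure (density lborel g) (A i))" .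
  qed (auto intro!: sets_PiM_cong)
qed

lemma iid_std_normal_measurable:
  assumes "prob_space P" and "iid_std_normal P z"
  shows "z \<in> borel_measurable P"
proof -
  have "(\<lambda>\<omega>. z \<omega> $ i) \<in> borel_measurable P" for i
    using assms(2) by (auto simp: iid_std_normal_def distributed_def)
  then show ?thesis
    by (subst borel_measurable_euclidean_space) (auto simp: Basis_vec_def inner_axis)
qed

text \<open>Independence identifies the joint law with the product of the marginal laws; pulling the
  densities out of the product and passing from functions to vectors gives a density on the vector
  type.\<close>

lemma nn_integral_iid_std_normal:
  fixes z :: "'a \<Rightarrow> real ^ 'n"
  assumes P: "prob_space P" and z: "iid_std_normal P z" and [measurable]: "F \<in> borel_measurable borel"
  shows "(\<integral>\<^sup>+\<omega>. F (z \<omega>) \<partial>P)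
    = (\<integral>\<^sup>+x. ennreal (\<Prod>i\<in>UNIV. std_normal_density (x $ i)) * F x \<partial>lborel)"
proof -
  interpret prob_space P by (rule P)
  have ind: "indep_vars (\<lambda>_. borel) (\<lambda>i \<omega>. z \<omega> $ i) UNIV"
    and dist: "\<And>i. distributed P lborel (\<lambda>\<omega>. z \<omega> $ i) std_normal_density"
    using z by (auto simp: iid_std_normal_def)
  have rv[measurable]: "(\<lambda>\<omega>. z \<omega> $ i) \<in> borel_measurable P" for i
    using dist[of i] by (simp add: distributed_def)
  have d: "distr P borel (\<lambda>\<omega>. z \<omega> $ i) = density lborel std_normal_density" for i
    using dist[of i] unfolding distributed_def by (metis distr_cong sets_lborel)
  have law: "distr P (Pi\<^sub>M UNIV (\<lambda>_. borel)) (\<lambda>\<omega> i. z \<omega> $ i)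
      = Pi\<^sub>M (UNIV :: 'n set) (\<lambda>_. density lborel std_normal_density)"
    using ind indep_vars_iff_distr_eq_PiM[where I = "UNIV :: 'n set" and M' = "\<lambda>_. borel" and X = "\<lambda>i \<omega>. z \<omega> $ i"] rv
    by (simp add: d restrict_UNIV)
  have sf: "sigma_finite_measure (density lborel (\<lambda>x. ennreal (std_normal_density x)))"
    using prob_space_normal_density[of 1 0]
    by (simp add: prob_space_imp_sigma_finite)
  note [measurable] = measurable_vec_lambda_PiM[of "\<lambda>_ :: 'n. lborel"]
    measurable_vec_lambda_PiM[of "\<lambda>_ :: 'n. borel"]
  have "(\<integral>\<^sup>+\<omega>. F (z \<omega>) \<partial>P) = (\<integral>\<^sup>+\<omega>. F (\<chi> i. (\<lambda>i. z \<omega> $ i) i) \<partial>P)" by simp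
  also have "\<dots> = (\<integral>\<^sup>+f. F (\<chi> i. f i) \<partial>distr P (Pi\<^sub>M UNIV (\<lambda>_. borel)) (\<lambda>\<omega> i. z \<omega> $ i))"
    by (subst nn_integral_distr) (auto intro!: measurable_PiM_single')
  also have "\<dots> = (\<integral>\<^sup>+f. (\<Prod>i\<in>UNIV. ennreal (std_normal_density (f i))) * F (\<chi> i. f i)
      \<partial>Pi\<^sub>M UNIV (\<lambda>_. lborel))"
    unfolding law by (subst PiM_density, simp, rule sf, subst nn_integral_density) auto
  also have "\<dots> = (\<integral>\<^sup>+f. ennreal (\<Prod>i\<in>UNIV. std_normal_density ((\<chi> i. f i) $ i)) * F (\<chi> i. f i)
      \<partial>Pi\<^sub>M UNIV (\<lambda>_. lborel))"
    by (simp add: prod_ennreal)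
  also have "\<dots> = (\<integral>\<^sup>+x. ennreal (\<Prod>i\<in>UNIV. std_normal_density (x $ i)) * F x \<partial>lborel)"
    by (subst lborel_vec_eq_distr_PiM, subst nn_integral_distr) auto
  finally show ?thesis .
qed

section \<open>Rotation invariance of Lebesgue measure\<close>

text \<open>The condition on \<open>c\<close> leaves translations and point reflections, whose
  Jacobian is one. The argument for rotations below is assembled from these two.\<close>

lemma nn_integral_lborel_affine:
  fixes F :: "'b::euclidean_space \<Rightarrow> ennreal" and c :: real
  assumes [measurable]: "F \<in> borel_measurable borel" and c: "\<bar>c\<bar> = 1"
  shows "(\<integral>\<^sup>+x. F (t + c *\<^sub>R x) \<partial>lborel) = (\<integral>\<^sup>+x. F x \<partial>lborel)"
proof -
  have "c \<noteq> 0" using c by auto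
  then have "(\<integral>\<^sup>+x. F x \<partial>lborel) = (\<integral>\<^sup>+x. F x \<partial>distr lborel borel (\<lambda>x. t + c *\<^sub>R x))"
    by (subst lborel_affine[of c t]) (simp_all add: c density_1)
  also have "\<dots> = (\<integral>\<^sup>+x. F (t + c *\<^sub>R x) \<partial>lborel)"
    by (rule nn_integral_distr) auto
  finally show ?thesis by simp
qed

text \<open>Uniqueness of translation-invariant measures: the substitutions below show that the Lebesgue
  measure and its image under \<open>f\<close> are proportional, and both give the unit ball the same mass.
  The change of variables theorems of the library are restricted to index types of class wellorder.\<close>

lemma nn_integral_lborel_orthogonal_transformation:
  fixes f :: "'b::euclidean_space \<Rightarrow> 'b" and F :: "'b \<Rightarrow> ennreal"
  assumes f: "orthogonal_transformation f" and [measurable]: "F \<in> borel_measurable borel"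
  shows "(\<integral>\<^sup>+x. F (f x) \<partial>lborel) = (\<integral>\<^sup>+x. F x \<partial>lborel)"
proof -
  have lin: "linear f" using f by (rule orthogonal_transformation_linear)
  have [measurable]: "f \<in> borel_measurable borel"
    using lin by (intro borel_measurable_continuous_onI linear_continuous_on)
      (simp add: linear_conv_bounded_linear)
  define G :: "'b \<Rightarrow> ennreal" where "G = indicator (ball 0 1)"
  have [measurable]: "G \<in> borel_measurable borel"
    unfolding G_def by (intro borel_measurable_indicator borel_open) auto
  have G_f: "G (f x) = G x" for x
    using orthogonal_transformation_norm[OF f] by (simp add: G_def indicator_def)
  \<comment> \<open>Positive finite mass of \<open>G\<close> permits the final cancellation.\<close>
  have G_pos: "(\<integral>\<^sup>+x. G x \<partial>lborel) \<noteq> 0" "(\<integral>\<^sup>+x. G x \<partial>lborel) \<noteq> \<infinity>"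
    using emeasure_lborel_ball_finite[of "0 :: 'b" 1] content_ball_pos[of 1 "0 :: 'b"]
    by (auto simp: G_def measure_def)
  have "(\<integral>\<^sup>+x. F (f x) \<partial>lborel) * (\<integral>\<^sup>+x. G x \<partial>lborel)
      = (\<integral>\<^sup>+x. F (f x) * (\<integral>\<^sup>+y. G y \<partial>lborel) \<partial>lborel)"
    by (simp add: nn_integral_multc)
  also have "\<dots> = (\<integral>\<^sup>+x. (\<integral>\<^sup>+y. F (f x) * G (f x + 1 *\<^sub>R y) \<partial>lborel) \<partial>lborel)"
    by (subst nn_integral_cmult, simp, subst nn_integral_lborel_affine) auto
  also have "\<dots> = (\<integral>\<^sup>+y. (\<integral>\<^sup>+x. F (f x) * G (f x + 1 *\<^sub>R y) \<partial>lborel) \<partial>lborel)"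
    by (rule lborel_pair.Fubini') measurable
  also have "\<dots> = (\<integral>\<^sup>+y. (\<integral>\<^sup>+x. F (f x - y) * G (f x) \<partial>lborel) \<partial>lborel)"
  proof (rule nn_integral_cong)
    fix y
    \<comment> \<open>Since \<open>f\<close> is onto, \<open>- y\<close> has a preimage
      \<open>w\<close>; shifting \<open>x\<close> by \<open>w\<close> moves \<open>y\<close> from
      the argument of \<open>G\<close> to that of \<open>F\<close>.\<close>
    obtain w where w: "f w = - y"
      using orthogonal_transformation_surj[OF f] by (metis surjD)
    have "(\<integral>\<^sup>+x. F (f x) * G (f x + 1 *\<^sub>R y) \<partial>lborel)
        = (\<integral>\<^sup>+x. F (f (w + 1 *\<^sub>R x)) * G (f (w + 1 *\<^sub>R x) + 1 *\<^sub>R y) \<partial>lborel)"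
      by (subst nn_integral_lborel_affine) auto
    also have "\<dots> = (\<integral>\<^sup>+x. F (f x - y) * G (f x) \<partial>lborel)"
      by (simp add: linear_add[OF lin] w)
    finally show "(\<integral>\<^sup>+x. F (f x) * G (f x + 1 *\<^sub>R y) \<partial>lborel) = (\<integral>\<^sup>+x. F (f x - y) * G (f x) \<partial>lborel)" .
  qed
  also have "\<dots> = (\<integral>\<^sup>+x. (\<integral>\<^sup>+y. F (f x - y) * G (f x) \<partial>lborel) \<partial>lborel)"
    by (rule lborel_pair.Fubini'[symmetric]) measurable
  also have "\<dots> = (\<integral>\<^sup>+x. (\<integral>\<^sup>+y. F y \<partial>lborel) * G (f x) \<partial>lborel)"
  proof (rule nn_integral_cong)
    fix x
    have "(\<integral>\<^sup>+y. F (f x + (-1) *\<^sub>R y) \<partial>lborel) = (\<integral>\<^sup>+y. F y \<partial>lborel)"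
      by (rule nn_integral_lborel_affine) auto
    then show "(\<integral>\<^sup>+y. F (f x - y) * G (f x) \<partial>lborel) = (\<integral>\<^sup>+y. F y \<partial>lborel) * G (f x)"
      by (simp add: nn_integral_multc)
  qed
  also have "\<dots> = (\<integral>\<^sup>+y. F y \<partial>lborel) * (\<integral>\<^sup>+x. G x \<partial>lborel)"
    by (simp add: G_f nn_integral_cmult)
  finally show ?thesis
    using G_pos by (simp add: ennreal_mult_cancel_left mult.commute[of _ "nn_integral lborel G"])
qed

section \<open>Exponential moments of Gaussian quadratic forms\<close>

text \<open>After taking logarithms, each sign of \<open>u\<close> is settled by the monotonicity of
  a function vanishing at \<open>0\<close>. The number \<open>v\<close> will be a common upper bound
  over all eigenvalues, so that the exponents have one denominator and can be summed over the
  coordinates.\<close>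

lemma exp_minus_half_div_sqrt_le:
  fixes u v :: real
  assumes "u \<le> v" "0 \<le> v" "v < 1"
  shows "1 / sqrt (1 - u) \<le> exp (u / 2 + u\<^sup>2 / (4 * (1 - v)))"
proof -
  have main: "- ln (1 - u) - u \<le> u\<^sup>2 / (2 * (1 - v))"
  proof (cases "0 \<le> u")
    case True
    define f where "f t = - ln (1 - t) - t - t\<^sup>2 / (2 * (1 - t))" for t :: real
    have "f u \<le> f 0"
    proof (rule DERIV_nonpos_imp_nonincreasing[OF True])
      fix t assume t: "0 \<le> t" "t \<le> u"
      then have t1: "1 - t > 0" using assms by simp
      have "(f has_real_derivative (1 / (1 - t) - 1 - (2 * t * (2 * (1 - t)) + 2 * t\<^sup>2) / (2 * (1 - t))\<^sup>2)) (at t)"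
        unfolding f_def using t1
        by (auto intro!: derivative_eq_intros simp: power2_eq_square)
      moreover have "1 / (1 - t) - 1 - (2 * t * (2 * (1 - t)) + 2 * t\<^sup>2) / (2 * (1 - t))\<^sup>2
          = - (t\<^sup>2 / (2 * (1 - t)\<^sup>2))"
        using t1 by (simp add: divide_simps) (simp add: algebra_simps power2_eq_square power3_eq_cube)
      ultimately show "\<exists>y. (f has_real_derivative y) (at t) \<and> y \<le> 0"
        by (metis divide_nonneg_nonneg neg_le_0_iff_le zero_le_mult_iff zero_le_numeral zero_le_power2)
    qed
    then have "- ln (1 - u) - u \<le> u\<^sup>2 / (2 * (1 - u))" by (simp add: f_def)
    also have "\<dots> \<le> u\<^sup>2 / (2 * (1 - v))" using assms by (intro divide_left_mono) auto
    finally show ?thesis .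
  next
    case False
    \<comment> \<open>For negative \<open>u\<close> the comparison is with
      \<open>u\<^sup>2 / 2\<close>, which is at most the target because
      \<open>0 \<le> v\<close>.\<close>
    define f where "f t = - ln (1 - t) - t - t\<^sup>2 / 2" for t :: real
    have "f u \<le> f 0"
    proof (rule DERIV_nonneg_imp_nondecreasing[of u 0 f])
      show "u \<le> 0" using False by simp
      fix t assume t: "u \<le> t" "t \<le> 0"
      then have t1: "1 - t > 0" by simp
      have "(f has_real_derivative (1 / (1 - t) - 1 - t)) (at t)"
        unfolding f_def using t1
        by (auto intro!: derivative_eq_intros)
      moreover have "1 / (1 - t) - 1 - t = t\<^sup>2 / (1 - t)"
        using t1 by (simp add: field_simps power2_eq_square)
      ultimately show "\<exists>y. (f has_real_derivative y) (at t) \<and> 0 \<le> y"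
        using t1 by (metis divide_nonneg_pos zero_le_power2)
    qed
    then have "- ln (1 - u) - u \<le> u\<^sup>2 / 2" by (simp add: f_def)
    also have "\<dots> \<le> u\<^sup>2 / (2 * (1 - v))" using assms by (intro divide_left_mono) auto
    finally show ?thesis .
  qed
  have u1: "1 - u > 0" using assms by simp
  have "exp (- (ln (1 - u) / 2)) = 1 / sqrt (1 - u)"
    using u1 by (simp add: exp_minus ln_sqrt[symmetric] inverse_eq_divide)
  moreover have "- (ln (1 - u) / 2) \<le> u / 2 + u\<^sup>2 / (4 * (1 - v))"
  proof -
    define W where "W = u\<^sup>2 / (2 * (1 - v))"
    have "u\<^sup>2 / (4 * (1 - v)) = W / 2" by (simp add: W_def)
    with main[folded W_def] show ?thesis by linarith
  qed
  ultimately show ?thesis by (metis exp_le_cancel_iff)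
qed

lemma orthogonal_matrix_inner:
  fixes U :: "real ^ 'n ^ 'n"
  assumes "orthogonal_matrix U"
  shows "(transpose U *v x) \<bullet> (transpose U *v y) = x \<bullet> y"
  using assms unfolding inner_transpose_matrix_vector orthogonal_matrix_def
  by (simp only: matrix_vector_mul_assoc matrix_vector_mul_lid)

text \<open>In this form the joint density visibly depends on \<open>x\<close> only through
  \<open>x \<bullet> x\<close>, so rotations leave it unchanged.\<close>

lemma prod_std_normal_density:
  "(\<Prod>i\<in>UNIV. std_normal_density (x $ i)) = (1 / sqrt (2 * pi)) ^ CARD('n) * exp (- (x \<bullet> x) / 2)"
  for x :: "real ^ 'n"
proof -
  have "(\<Prod>i\<in>UNIV. std_normal_density (x $ i))
      = (1 / sqrt (2 * pi)) ^ CARD('n) * (\<Prod>i\<in>UNIV. exp (- (x $ i)\<^sup>2 / 2))"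
    by (simp add: std_normal_density_def prod.distrib power_divide prod_dividef)
  also have "(\<Prod>i\<in>UNIV. exp (- (x $ i)\<^sup>2 / 2)) = exp (\<Sum>i\<in>UNIV. - (x $ i)\<^sup>2 / 2)"
    by (simp add: exp_sum)
  also have "(\<Sum>i\<in>UNIV. - (x $ i)\<^sup>2 / 2) = - (x \<bullet> x) / 2"
    by (simp add: inner_vec_def power2_eq_square sum_negf sum_divide_distrib)
  finally show ?thesis .
qed

text \<open>The joint density and Lebesgue measure are both invariant under
  \<open>transpose U\<close>, so the rotated coordinates behave as independent standard normals and
  the integral factors into one-dimensional ones.\<close>

lemma gaussian_exp_quadratic:
  fixes z :: "'a \<Rightarrow> real ^ 'n" and U :: "real ^ 'n ^ 'n"
  assumes P: "prob_space P" and z: "iid_std_normal P z" and U: "orthogonal_matrix U"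
    and p: "\<And>i. 2 * p i < 1"
  shows "(\<integral>\<^sup>+\<omega>. ennreal (exp (\<Sum>i\<in>UNIV. p i * ((transpose U *v z \<omega>) $ i)\<^sup>2
        + q i * (transpose U *v z \<omega>) $ i)) \<partial>P)
    = ennreal (\<Prod>i\<in>UNIV. exp ((q i)\<^sup>2 / (2 * (1 - 2 * p i))) / sqrt (1 - 2 * p i))"
proof -
  define H where "H w = (\<Prod>i\<in>UNIV. ennreal (std_normal_density (w $ i) * exp (p i * (w $ i)\<^sup>2 + q i * w $ i)))"
    for w :: "real ^ 'n"
  have H_m[measurable]: "H \<in> borel_measurable borel" unfolding H_def by measurable
  have tr: "orthogonal_transformation ((*v) (transpose U))"
    unfolding orthogonal_transformation_def
    using orthogonal_matrix_inner[OF U] by (auto simp: matrix_vector_mul_linear simp del: transpose_matrix_vector)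
  have [measurable]: "(\<lambda>x. (transpose U *v x) $ i) \<in> borel_measurable borel" for i
    unfolding matrix_vector_mul_component by measurable
  have H_tr: "ennreal (\<Prod>i\<in>UNIV. std_normal_density (x $ i)) *
      ennreal (exp (\<Sum>i\<in>UNIV. p i * ((transpose U *v x) $ i)\<^sup>2 + q i * (transpose U *v x) $ i))
      = H (transpose U *v x)" for x
  proof -
    let ?w = "transpose U *v x"
    have "(\<Prod>i\<in>UNIV. std_normal_density (x $ i)) = (\<Prod>i\<in>UNIV. std_normal_density (?w $ i))"
      unfolding prod_std_normal_density orthogonal_matrix_inner[OF U] ..
    then show ?thesis
      by (simp add: H_def exp_sum prod_ennreal ennreal_mult[symmetric] prod.distrib prod_nonneg
          del: transpose_matrix_vector)
  qed
  have "(\<integral>\<^sup>+\<omega>. ennreal (exp (\<Sum>i\<in>UNIV. p i * ((transpose U *v z \<omega>) $ i)\<^sup>2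
        + q i * (transpose U *v z \<omega>) $ i)) \<partial>P) = (\<integral>\<^sup>+x. H (transpose U *v x) \<partial>lborel)"
    unfolding H_tr[symmetric] by (rule nn_integral_iid_std_normal[OF P z]) measurable
  also have "\<dots> = (\<integral>\<^sup>+x. H x \<partial>lborel)"
    by (rule nn_integral_lborel_orthogonal_transformation[OF tr H_m])
  also have "\<dots> = (\<Prod>i\<in>UNIV. ennreal (exp ((q i)\<^sup>2 / (2 * (1 - 2 * p i))) / sqrt (1 - 2 * p i)))"
    unfolding H_def by (subst nn_integral_lborel_vec_prod) (simp_all add: gaussian_exp_quadratic_1d p)
  also have "\<dots> = ennreal (\<Prod>i\<in>UNIV. exp ((q i)\<^sup>2 / (2 * (1 - 2 * p i))) / sqrt (1 - 2 * p i))"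
    using p by (intro prod_ennreal) (simp add: less_imp_le)
  finally show ?thesis .
qed

section \<open>First and second moments of Gaussian vectors\<close>

lemma iid_std_normal_moments:
  fixes z :: "'a \<Rightarrow> real ^ 'n"
  assumes P: "prob_space P" and z: "iid_std_normal P z"
  shows "integrable P (\<lambda>\<omega>. z \<omega> $ i)" "(\<integral>\<omega>. z \<omega> $ i \<partial>P) = 0"
    "integrable P (\<lambda>\<omega>. z \<omega> $ i * z \<omega> $ j)" "(\<integral>\<omega>. z \<omega> $ i * z \<omega> $ j \<partial>P) = (if i = j then 1 else 0)"
proof -
  interpret prob_space P by (rule P)
  have ind: "indep_vars (\<lambda>_. borel) (\<lambda>i \<omega>. z \<omega> $ i) UNIV"
    and dist: "\<And>i. distributed P lborel (\<lambda>\<omega>. z \<omega> $ i) std_normal_density"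
    using z by (auto simp: iid_std_normal_def)
  have pow: "integrable P (\<lambda>\<omega>. (z \<omega> $ k) ^ n)" for k n
    using distributed_integrable[OF dist[of k], of "\<lambda>x. x ^ n"] integrable_std_normal_moment[of n] by simp
  show int1: "integrable P (\<lambda>\<omega>. z \<omega> $ k)" for k using pow[of k 1] by simp
  show mean: "(\<integral>\<omega>. z \<omega> $ k \<partial>P) = 0" for k
    using distributed_integral[OF dist[of k], of "\<lambda>x. x"] integral_std_normal_moment_odd[of 0]
    by simp
  have "integrable P (\<lambda>\<omega>. z \<omega> $ i * z \<omega> $ j) \<and> (\<integral>\<omega>. z \<omega> $ i * z \<omega> $ j \<partial>P) = (if i = j then 1 else 0)"
  proof (cases "i = j")
    case True
    have "(\<integral>\<omega>. (z \<omega> $ i)\<^sup>2 \<partial>P) = 1"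
      using distributed_integral[OF dist[of i], of "\<lambda>x. x\<^sup>2"] integral_std_normal_moment_even[of 1]
      by simp
    then show ?thesis using True pow[of i 2] by (simp add: power2_eq_square)
  next
    case False
    have ind2: "indep_vars (\<lambda>_. borel) (\<lambda>i \<omega>. z \<omega> $ i) {i, j}"
      using ind by (rule indep_vars_subset) auto
    show ?thesis
      using indep_vars_integrable[OF _ ind2] indep_vars_lebesgue_integral[OF _ ind2] False int1 mean
      by simp
  qed
  then show "integrable P (\<lambda>\<omega>. z \<omega> $ i * z \<omega> $ j)"
    "(\<integral>\<omega>. z \<omega> $ i * z \<omega> $ j \<partial>P) = (if i = j then 1 else 0)" by auto
qed

lemma
  fixes z :: "'a \<Rightarrow> real ^ 'n"
  assumes P: "prob_space P" and z: "iid_std_normal P z"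
  shows integrable_inner_std_normal: "integrable P (\<lambda>\<omega>. c \<bullet> z \<omega>)"
    and integral_inner_std_normal: "(\<integral>\<omega>. c \<bullet> z \<omega> \<partial>P) = 0"
    and integrable_quadratic_std_normal: "integrable P (\<lambda>\<omega>. z \<omega> \<bullet> (G *v z \<omega>))"
    and integral_quadratic_std_normal: "(\<integral>\<omega>. z \<omega> \<bullet> (G *v z \<omega>) \<partial>P) = trace G"
proof -
  note mom = iid_std_normal_moments[OF P z]
  show "integrable P (\<lambda>\<omega>. c \<bullet> z \<omega>)" "(\<integral>\<omega>. c \<bullet> z \<omega> \<partial>P) = 0"
    by (simp_all add: inner_vec_def mom)
  have quad: "z \<omega> \<bullet> (G *v z \<omega>) = (\<Sum>i\<in>UNIV. \<Sum>j\<in>UNIV. G $ i $ j * (z \<omega> $ i * z \<omega> $ j))" for \<omega>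
    by (simp add: inner_vec_def matrix_vector_mult_def sum_distrib_left mult_ac)
  show "integrable P (\<lambda>\<omega>. z \<omega> \<bullet> (G *v z \<omega>))"
    unfolding quad by (intro Bochner_Integration.integrable_sum integrable_mult_right mom)
  have "(\<integral>\<omega>. z \<omega> \<bullet> (G *v z \<omega>) \<partial>P) = (\<Sum>i\<in>UNIV. \<Sum>j\<in>UNIV. G $ i $ j * (\<integral>\<omega>. z \<omega> $ i * z \<omega> $ j \<partial>P))"
    unfolding quad by (simp add: mom(3))
  also have "\<dots> = trace G"
    by (simp add: mom(4) trace_def if_distrib cong: if_cong)
  finally show "(\<integral>\<omega>. z \<omega> \<bullet> (G *v z \<omega>) \<partial>P) = trace G" .
qed

text \<open>The penalty \<open>\<theta> * \<gamma>\<close> pays for the linear term: by the last hypothesis it absorbs the contribution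
  \<open>2 * t\<^sup>2 * (norm b)\<^sup>2 / (1 - 2 * t * s)\<close> of \<open>b\<close> to the logarithm of the exponential moment.\<close>

lemma gaussian_chaos_exp_moment:
  fixes z :: "'a \<Rightarrow> real ^ 'n" and U :: "real ^ 'n ^ 'n"
  assumes P: "prob_space P" and z: "iid_std_normal P z"
    and U: "orthogonal_matrix U" and A: "A = U ** diag_mat d ** transpose U"
    and ds: "\<And>i. d i \<le> s" and s: "0 \<le> s" and t: "0 < t" and ts: "2 * t * s < 1"
    and b: "(norm b)\<^sup>2 \<le> r * \<gamma>" and \<gamma>: "0 \<le> \<gamma>" and tr: "2 * t * r \<le> \<theta> * (1 - 2 * t * s)"
  shows "(\<integral>\<^sup>+\<omega>. ennreal (exp (t * (z \<omega> \<bullet> (A *v z \<omega>) - 2 * (b \<bullet> z \<omega>) - \<theta> * \<gamma>))) \<partial>P)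
    \<le> ennreal (exp (t * trace A + t\<^sup>2 * (norm A)\<^sup>2 / (1 - 2 * t * s)))"
proof -
  define v where "v = 1 - 2 * t * s"
  have v: "v > 0" using ts by (simp add: v_def)
  define b' where "b' = transpose U *v b"
  define p where "p i = t * d i" for i
  define q where "q i = - 2 * t * b' $ i" for i
  have p_le: "2 * p i \<le> 2 * t * s" for i
    using mult_left_mono[OF ds[of i], of "2 * t"] t by (simp add: p_def)
  then have p_lt: "2 * p i < 1" for i using ts by (meson le_less_trans)
  have expand: "t * (z \<omega> \<bullet> (A *v z \<omega>) - 2 * (b \<bullet> z \<omega>) - \<theta> * \<gamma>)
      = - (t * \<theta> * \<gamma>) + (\<Sum>i\<in>UNIV. p i * ((transpose U *v z \<omega>) $ i)\<^sup>2 + q i * (transpose U *v z \<omega>) $ i)" for \<omega>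
  proof -
    have "b \<bullet> z \<omega> = (\<Sum>i\<in>UNIV. b' $ i * (transpose U *v z \<omega>) $ i)"
      using orthogonal_matrix_inner[OF U, of b "z \<omega>"]
      unfolding b'_def by (simp only: inner_vec_def inner_real_def)
    then show ?thesis
      by (simp add: quadratic_form_diagonalized[OF U A] sum.distrib sum_subtractf sum_distrib_left
          p_def q_def algebra_simps sum_negf del: transpose_matrix_vector)
  qed
  \<comment> \<open>Replacing each \<open>1 - 2 * p i\<close> by its common lower bound
    \<open>v\<close> makes the exponents add up to the squared norm of \<open>b\<close>, the trace
    and the squared Frobenius norm.\<close>
  have factor: "exp ((q i)\<^sup>2 / (2 * (1 - 2 * p i))) / sqrt (1 - 2 * p i)
      \<le> exp (2 * t\<^sup>2 / v * (b' $ i)\<^sup>2 + t * d i + t\<^sup>2 / v * (d i)\<^sup>2)" for i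
  proof -
    have "v \<le> 1 - 2 * p i" using p_le[of i] by (simp add: v_def)
    then have "(q i)\<^sup>2 / (2 * (1 - 2 * p i)) \<le> (q i)\<^sup>2 / (2 * v)"
      using v by (intro divide_left_mono) auto
    also have "\<dots> = 2 * t\<^sup>2 / v * (b' $ i)\<^sup>2"
      using v by (simp add: q_def power_mult_distrib)
    finally have 1: "exp ((q i)\<^sup>2 / (2 * (1 - 2 * p i))) \<le> exp (2 * t\<^sup>2 / v * (b' $ i)\<^sup>2)" by simp
    have "1 / sqrt (1 - 2 * p i) \<le> exp (2 * p i / 2 + (2 * p i)\<^sup>2 / (4 * (1 - 2 * t * s)))"
      using p_le s t ts by (intro exp_minus_half_div_sqrt_le) auto
    also have "2 * p i / 2 + (2 * p i)\<^sup>2 / (4 * (1 - 2 * t * s)) = t * d i + t\<^sup>2 / v * (d i)\<^sup>2"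
      by (simp add: p_def v_def[symmetric] power_mult_distrib)
    finally have 2: "1 / sqrt (1 - 2 * p i) \<le> exp (t * d i + t\<^sup>2 / v * (d i)\<^sup>2)" .
    have "exp ((q i)\<^sup>2 / (2 * (1 - 2 * p i))) * (1 / sqrt (1 - 2 * p i))
        \<le> exp (2 * t\<^sup>2 / v * (b' $ i)\<^sup>2) * exp (t * d i + t\<^sup>2 / v * (d i)\<^sup>2)"
      using p_lt[of i] by (intro mult_mono 1 2) auto
    then show ?thesis by (simp add: exp_add[symmetric] add.assoc)
  qed
  have "(\<integral>\<^sup>+\<omega>. ennreal (exp (t * (z \<omega> \<bullet> (A *v z \<omega>) - 2 * (b \<bullet> z \<omega>) - \<theta> * \<gamma>))) \<partial>P)
      = (\<integral>\<^sup>+\<omega>. ennreal (exp (- (t * \<theta> * \<gamma>))) * ennreal (exp (\<Sum>i\<in>UNIV. p i * ((transpose U *v z \<omega>) $ i)\<^sup>2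
        + q i * (transpose U *v z \<omega>) $ i)) \<partial>P)"
    unfolding expand by (simp only: exp_add ennreal_mult exp_ge_zero)
  also have "\<dots> = ennreal (exp (- (t * \<theta> * \<gamma>))) * (\<integral>\<^sup>+\<omega>. ennreal (exp (\<Sum>i\<in>UNIV. p i * ((transpose U *v z \<omega>) $ i)\<^sup>2
        + q i * (transpose U *v z \<omega>) $ i)) \<partial>P)"
  proof (rule nn_integral_cmult)
    have [measurable]: "z \<in> borel_measurable P" by (rule iid_std_normal_measurable[OF P z])
    have [measurable]: "(\<lambda>\<omega>. (transpose U *v z \<omega>) $ i) \<in> borel_measurable P" for i
      unfolding matrix_vector_mul_component by measurable
    show "(\<lambda>\<omega>. ennreal (exp (\<Sum>i\<in>UNIV. p i * ((transpose U *v z \<omega>) $ i)\<^sup>2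
        + q i * (transpose U *v z \<omega>) $ i))) \<in> borel_measurable P" by measurable
  qed
  also have "\<dots> = ennreal (exp (- (t * \<theta> * \<gamma>))) *
      ennreal (\<Prod>i\<in>UNIV. exp ((q i)\<^sup>2 / (2 * (1 - 2 * p i))) / sqrt (1 - 2 * p i))"
    by (simp only: gaussian_exp_quadratic[OF P z U p_lt])
  also have "\<dots> \<le> ennreal (exp (- (t * \<theta> * \<gamma>))) *
      ennreal (\<Prod>i\<in>UNIV. exp (2 * t\<^sup>2 / v * (b' $ i)\<^sup>2 + t * d i + t\<^sup>2 / v * (d i)\<^sup>2))"
    using factor p_lt by (intro mult_left_mono ennreal_leI prod_mono) (auto simp: less_imp_le)
  also have "\<dots> = ennreal (exp (- (t * \<theta> * \<gamma>) +
      (2 * t\<^sup>2 / v * (\<Sum>i\<in>UNIV. (b' $ i)\<^sup>2) + t * (\<Sum>i\<in>UNIV. d i) + t\<^sup>2 / v * (\<Sum>i\<in>UNIV. (d i)\<^sup>2))))"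
    by (simp add: exp_sum[symmetric] ennreal_mult[symmetric] exp_add[symmetric] sum.distrib sum_distrib_left)
  also have "(\<Sum>i\<in>UNIV. (b' $ i)\<^sup>2) = (norm b)\<^sup>2"
  proof -
    have "(\<Sum>i\<in>UNIV. (b' $ i)\<^sup>2) = b' \<bullet> b'" by (simp add: inner_vec_def power2_eq_square)
    then show ?thesis unfolding b'_def orthogonal_matrix_inner[OF U] by (simp add: power2_norm_eq_inner)
  qed
  also have "- (t * \<theta> * \<gamma>) + (2 * t\<^sup>2 / v * (norm b)\<^sup>2 + t * (\<Sum>i\<in>UNIV. d i) + t\<^sup>2 / v * (\<Sum>i\<in>UNIV. (d i)\<^sup>2))
      \<le> t * trace A + t\<^sup>2 * (norm A)\<^sup>2 / (1 - 2 * t * s)"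
  proof -
    have "2 * t\<^sup>2 / v * (norm b)\<^sup>2 \<le> 2 * t\<^sup>2 / v * (r * \<gamma>)"
      using v by (intro mult_left_mono b) auto
    also have "\<dots> = t / v * \<gamma> * (2 * t * r)" by (simp add: power2_eq_square)
    also have "\<dots> \<le> t / v * \<gamma> * (\<theta> * v)"
      using tr t v \<gamma> by (intro mult_left_mono) (auto simp: v_def)
    also have "\<dots> = t * \<theta> * \<gamma>" using v by simp
    finally show ?thesis
      by (simp add: trace_diagonalized[OF U A] norm_diagonalized[OF U A] v_def)
  qed
  finally show ?thesis by (simp add: ennreal_leI)
qed

section \<open>The penalized estimator\<close>

text \<open>The expected excess is at most the exponential moment times
  \<open>exp (- (t * Q)) / (2 * t)\<close>. The terms of \<open>Q\<close> with \<open>L\<close> and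
  \<open>sqrt (L + h)\<close> produce \<open>exp (- L)\<close>, and the square term pays for
  \<open>1 / (2 * t)\<close>. In the application \<open>\<gamma>\<close> is the squared norm of the
  bias.\<close>

lemma gaussian_chaos_expected_excess:
  fixes z :: "'a \<Rightarrow> real ^ 'n" and A :: "real ^ 'n ^ 'n"
  assumes P: "prob_space P" and z: "iid_std_normal P z" and sym: "transpose A = A"
    and b: "(norm b)\<^sup>2 \<le> r * \<gamma>" and \<gamma>: "0 \<le> \<gamma>" and r: "0 \<le> r"
    and \<theta>: "0 < \<theta>" and L: "0 < L" and h: "0 < h" and lam: "0 < lam"
  defines "s \<equiv> max_pos_eigenvalue A" and "a \<equiv> norm A"
  defines "Q \<equiv> trace A + 2 * (r / \<theta> + s) * L + 2 * a * sqrt (L + h)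
      + lam * (a / (sqrt L + sqrt (L + h)) + r / \<theta> + s)\<^sup>2"
  shows "(\<integral>\<^sup>+\<omega>. ennreal (max 0 (z \<omega> \<bullet> (A *v z \<omega>) - 2 * (b \<bullet> z \<omega>) - \<theta> * \<gamma> - Q)) \<partial>P)
    \<le> ennreal (exp (- L) / lam)"
proof -
  obtain U d where U: "orthogonal_matrix U" and A: "A = U ** diag_mat d ** transpose U"
    using symmetric_diagonalization[OF sym] by metis
  have ds: "\<And>i. d i \<le> s" and s: "0 \<le> s" and s_cases: "s = 0 \<or> s \<in> range d"
    using max_pos_eigenvalue_diagonalized[OF U A] by (auto simp: s_def)
  have a0: "0 \<le> a" by (simp add: a_def)
  \<comment> \<open>This is the coefficient of \<open>L\<close> in \<open>Q\<close>;
    \<open>w\<close> below is the bracket squared there.\<close>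
  define c where "c = 2 * (r / \<theta> + s)"
  have c0: "0 \<le> c" and sc: "2 * s \<le> c" using r \<theta> s by (auto simp: c_def)
  define l where "l = sqrt (L + h)"
  have l0: "0 < l" and l2: "l\<^sup>2 = L + h" using L h by (auto simp: l_def)
  define w where "w = a / (sqrt L + l) + r / \<theta> + s"
  have w_c: "w = a / (sqrt L + l) + c / 2" by (simp add: w_def c_def)
  have Q: "Q = trace A + c * L + 2 * a * l + lam * w\<^sup>2"
    unfolding Q_def c_def l_def w_def by simp
  show ?thesis
  proof (cases "a = 0 \<and> c = 0")
    \<comment> \<open>In this case the denominator \<open>D\<close> below would be zero. Here
      \<open>A\<close> and \<open>b\<close> vanish, so the variable is nonpositive while
      \<open>Q \<ge> 0\<close>, and the excess is zero.\<close>
    case True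
    then have "A = 0" by (simp add: a_def)
    moreover have "r = 0"
    proof -
      have "r / \<theta> + s = 0" "0 \<le> r / \<theta>" using True r \<theta> by (auto simp: c_def)
      then have "r / \<theta> = 0" using s by linarith
      then show ?thesis using \<theta> by simp
    qed
    then have "b = 0" using b by simp
    moreover have "trace A = 0" using \<open>A = 0\<close> by (simp add: trace_def)
    then have "Q \<ge> 0" using True lam by (simp add: Q)
    moreover have "0 \<le> \<theta> * \<gamma>" using \<theta> \<gamma> by simp
    ultimately have "max 0 (z \<omega> \<bullet> (A *v z \<omega>) - 2 * (b \<bullet> z \<omega>) - \<theta> * \<gamma> - Q) = 0" for \<omega>
      by simp
    then show ?thesis by simp
  next
    case False
    define D where "D = a + c * l"
    have D: "D > 0"
    proof (cases "a = 0")
      case True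
      then have "c > 0" using False c0 by simp
      then show ?thesis using True l0 by (simp add: D_def)
    next
      case False
      moreover have "0 \<le> c * l" using c0 l0 by simp
      ultimately show ?thesis using a0 unfolding D_def by linarith
    qed
    text \<open>This \<open>t\<close> is optimal for a tail of mass \<open>exp (- (L + h))\<close>, not \<open>exp (- L)\<close>; this gives
      \<open>1 / 2 \<le> t * w\<close>, so the \<open>lam * w\<^sup>2\<close> part of \<open>Q\<close> makes up for the factor \<open>1 / t\<close>.\<close>
    define t where "t = l / D"
    have t: "t > 0" using l0 D by (simp add: t_def)
    \<comment> \<open>This identity makes \<open>t\<close> admissible: since
      \<open>2 * s \<le> c\<close>, it bounds \<open>1 - 2 * t * s\<close> below by
      \<open>a / D\<close>, and \<open>t * c \<le> 1\<close> is the absorption condition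
      \<open>tr\<close> in disguise.\<close>
    have tc: "1 - t * c = a / D" using D by (simp add: t_def D_def field_simps)
    have aD: "0 \<le> a / D" using a0 D by simp
    have ts_tc: "2 * t * s \<le> t * c" using mult_left_mono[OF sc, of t] t by simp
    \<comment> \<open>For \<open>a = 0\<close> the identity gives only
      \<open>2 * t * s \<le> 1\<close>; the strict inequality then comes from
      \<open>s = 0\<close>.\<close>
    have s_zero: "s = 0" if "a = 0"
    proof -
      have "(\<Sum>i\<in>UNIV. (d i)\<^sup>2) = 0" using norm_diagonalized[OF U A] that by (simp add: a_def)
      then have "d i = 0" for i by (simp add: sum_nonneg_eq_0_iff)
      then show ?thesis using s_cases by auto
    qed
    have ts: "2 * t * s < 1"
    proof (cases "a = 0")
      case False
      then have "a / D > 0" using a0 D by simp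
      then show ?thesis using ts_tc tc by linarith
    qed (simp add: s_zero)
    have tr: "2 * t * r \<le> \<theta> * (1 - 2 * t * s)"
    proof -
      have "2 * t * (r / \<theta> + s) \<le> 1" using tc aD by (simp add: c_def algebra_simps)
      then have "\<theta> * (2 * t * (r / \<theta> + s)) \<le> \<theta> * 1" using \<theta> by (intro mult_left_mono) auto
      moreover have "\<theta> * (2 * t * (r / \<theta> + s)) = 2 * t * r + \<theta> * (2 * t * s)"
        using \<theta> by (simp add: field_simps)
      ultimately show ?thesis by (simp add: algebra_simps)
    qed
    have variance: "t\<^sup>2 * a\<^sup>2 / (1 - 2 * t * s) \<le> l\<^sup>2 * a / D"
    proof (cases "a = 0")
      case False
      then have "a / D > 0" using a0 D by simp
      then have "t\<^sup>2 * a\<^sup>2 / (1 - 2 * t * s) \<le> t\<^sup>2 * a\<^sup>2 / (a / D)"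
        using ts_tc tc by (intro divide_left_mono mult_pos_pos) auto
      also have "\<dots> = l\<^sup>2 * a / D"
        using False D by (simp add: t_def power2_eq_square field_simps)
      finally show ?thesis .
    qed simp
    \<comment> \<open>Here \<open>h\<close> enters through \<open>l\<^sup>2 = L + h \<ge> L\<close>:
      after the variance term is subtracted, the two terms of \<open>Q\<close> in \<open>L\<close>
      and \<open>l\<close> still contribute at least \<open>L\<close>.\<close>
    have exponent: "t * trace A + t\<^sup>2 * a\<^sup>2 / (1 - 2 * t * s) - t * Q \<le> - L - t * (lam * w\<^sup>2)"
    proof -
      have "t * (c * L + 2 * a * l) - l\<^sup>2 * a / D = (c * l * L + l\<^sup>2 * a) / D"
        using D by (simp add: t_def power2_eq_square field_simps)
      also have "\<dots> \<ge> (c * l * L + L * a) / D"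
        using D a0 l2 h by (intro divide_right_mono add_left_mono mult_right_mono) auto
      also have "(c * l * L + L * a) / D = L" using D by (simp add: D_def field_simps)
      finally have "L \<le> t * (c * L + 2 * a * l) - l\<^sup>2 * a / D" .
      then show ?thesis using variance by (simp add: Q algebra_simps)
    qed
    \<comment> \<open>From \<open>sqrt L \<le> l\<close> it follows that
      \<open>w \<ge> a / (2 * l) + c / 2\<close>, and the right side is exactly
      \<open>D / (2 * l) = 1 / (2 * t)\<close>.\<close>
    have tw: "1 / 2 \<le> t * w"
    proof -
      have "sqrt L \<le> l" using h by (simp add: l_def)
      then have "a / (2 * l) \<le> a / (sqrt L + l)"
        using a0 L l0 by (intro divide_left_mono) (auto simp: add_nonneg_pos)
      then have "t * (a / (2 * l) + c / 2) \<le> t * w"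
        using t by (intro mult_left_mono) (auto simp: w_c)
      moreover have "a / (2 * l) + c / 2 = D / (2 * l)"
        using l0 by (simp add: D_def field_simps)
      then have "t * (a / (2 * l) + c / 2) = 1 / 2"
        using l0 D by (simp add: t_def)
      ultimately show ?thesis by simp
    qed
    \<comment> \<open>Combines \<open>2 \<le> exp 1\<close> with the tangent bound
      \<open>x \<le> exp (x - 1)\<close>. It serves twice: for the positive part and for the factor
      \<open>lam\<close>.\<close>
    have exp_ge: "2 * x \<le> exp x" for x :: real
    proof -
      have "2 \<le> exp (1 :: real)" using exp_ge_add_one_self[of 1] by simp
      moreover have "x \<le> exp (x - 1)" using exp_ge_add_one_self[of "x - 1"] by simp
      ultimately have "2 * exp (x - 1) \<le> exp 1 * exp (x - 1)" "x \<le> exp (x - 1)"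
        by (auto intro: mult_right_mono)
      then show ?thesis by (simp add: exp_add[symmetric])
    qed
    let ?Y = "\<lambda>\<omega>. z \<omega> \<bullet> (A *v z \<omega>) - 2 * (b \<bullet> z \<omega>) - \<theta> * \<gamma>"
    have "(\<integral>\<^sup>+\<omega>. ennreal (max 0 (?Y \<omega> - Q)) \<partial>P)
        \<le> (\<integral>\<^sup>+\<omega>. ennreal (exp (- (t * Q)) / (2 * t)) * ennreal (exp (t * ?Y \<omega>)) \<partial>P)"
    proof (rule nn_integral_mono)
      fix \<omega>
      have "2 * (t * (?Y \<omega> - Q)) \<le> exp (t * (?Y \<omega> - Q))" by (rule exp_ge)
      also have "\<dots> = exp (- (t * Q)) * exp (t * ?Y \<omega>)" by (simp add: exp_add[symmetric] algebra_simps)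
      finally have "?Y \<omega> - Q \<le> exp (- (t * Q)) / (2 * t) * exp (t * ?Y \<omega>)"
        using t by (simp add: field_simps)
      then have "max 0 (?Y \<omega> - Q) \<le> exp (- (t * Q)) / (2 * t) * exp (t * ?Y \<omega>)"
        using t by simp
      then show "ennreal (max 0 (?Y \<omega> - Q)) \<le> ennreal (exp (- (t * Q)) / (2 * t)) * ennreal (exp (t * ?Y \<omega>))"
        using t by (simp add: ennreal_mult[symmetric] ennreal_leI)
    qed
    also have "\<dots> = ennreal (exp (- (t * Q)) / (2 * t)) * (\<integral>\<^sup>+\<omega>. ennreal (exp (t * ?Y \<omega>)) \<partial>P)"
    proof (rule nn_integral_cmult)
      have [measurable]: "(\<lambda>\<omega>. z \<omega> \<bullet> (A *v z \<omega>)) \<in> borel_measurable P" "(\<lambda>\<omega>. b \<bullet> z \<omega>) \<in> borel_measurable P"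
        using integrable_quadratic_std_normal[OF P z] integrable_inner_std_normal[OF P z] by auto
      show "(\<lambda>\<omega>. ennreal (exp (t * ?Y \<omega>))) \<in> borel_measurable P" by measurable
    qed
    also have "\<dots> \<le> ennreal (exp (- (t * Q)) / (2 * t)) *
        ennreal (exp (t * trace A + t\<^sup>2 * a\<^sup>2 / (1 - 2 * t * s)))"
      unfolding a_def by (intro mult_left_mono gaussian_chaos_exp_moment[OF P z U A ds s t ts b \<gamma> tr]) auto
    also have "\<dots> = ennreal (exp (t * trace A + t\<^sup>2 * a\<^sup>2 / (1 - 2 * t * s) - t * Q) / (2 * t))"
      using t by (simp add: ennreal_mult[symmetric] exp_diff exp_minus field_simps)
    also have "\<dots> \<le> ennreal (exp (- L) / lam)"
    proof (rule ennreal_leI)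
      \<comment> \<open>Using \<open>exp_ge\<close> at \<open>t * (lam * w\<^sup>2)\<close> trades
        the factor \<open>1 / (2 * t)\<close> for \<open>1 / lam\<close>.\<close>
      have "lam \<le> 4 * (t * w)\<^sup>2 * lam"
        using power_mono[OF tw, of 2] lam by (simp add: power2_eq_square)
      also have "\<dots> = 2 * t * (2 * (t * (lam * w\<^sup>2)))" by (simp add: power2_eq_square)
      also have "\<dots> \<le> 2 * t * exp (t * (lam * w\<^sup>2))" using t exp_ge by (intro mult_left_mono) auto
      finally have lam_le: "lam \<le> 2 * t * exp (t * (lam * w\<^sup>2))" .
      have "exp (t * trace A + t\<^sup>2 * a\<^sup>2 / (1 - 2 * t * s) - t * Q) / (2 * t)
          \<le> exp (- L - t * (lam * w\<^sup>2)) / (2 * t)"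
        using exponent t by (intro divide_right_mono) auto
      also have "\<dots> = exp (- L) / (2 * t * exp (t * (lam * w\<^sup>2)))"
        by (simp add: exp_diff)
      also have "\<dots> \<le> exp (- L) / lam"
        using lam_le lam t by (intro divide_left_mono) auto
      finally show "exp (t * trace A + t\<^sup>2 * a\<^sup>2 / (1 - 2 * t * s) - t * Q) / (2 * t) \<le> exp (- L) / lam" .
    qed
    finally show ?thesis .
  qed
qed

section \<open>Matrix identities linking the model to the Gaussian bound\<close>

lemma transpose_scaleR: "transpose (c *\<^sub>R A) = c *\<^sub>R transpose A" for A :: "real ^ 'n ^ 'm"
  by (simp add: transpose_def vec_eq_iff)

lemma transpose_add: "transpose (A + B) = transpose A + transpose B" for A :: "real ^ 'n ^ 'm"
  by (simp add: transpose_def vec_eq_iff)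

lemma transpose_minus: "transpose (- A) = - transpose A" for A :: "real ^ 'n ^ 'm"
  by (simp add: transpose_def vec_eq_iff)

lemma transpose_matA: "transpose (matA R K \<theta> \<Psi>) = matA R K \<theta> \<Psi>"
  by (simp only: matA_def matrix_transpose_mul transpose_scaleR transpose_add transpose_minus
      transpose_transpose matrix_mul_assoc add_ac)

lemma inner_matrix_transpose: "x \<bullet> (transpose M *v y) = (M *v x) \<bullet> y" for M :: "real ^ 'n ^ 'm"
  using inner_transpose_matrix_vector[of "transpose M" x y] by (simp only: transpose_transpose)

lemma uminus_matrix_vector: "(- M) *v x = - (M *v x)" for M :: "real ^ 'n ^ 'm"
  by (simp add: matrix_vector_mult_def vec_eq_iff sum_negf)

text \<open>Identifies \<open>matA\<close> as the matrix of the part quadratic in the noise of the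
  fluctuation \<open>2 * (N \<bullet> e) - \<theta> * (norm e)\<^sup>2\<close>.\<close>

lemma matA_quadratic_form: "x \<bullet> (matA R K \<theta> \<Psi> *v x)
    = 2 * ((K *v (R *v x)) \<bullet> (\<Psi> *v (R *v x))) - \<theta> * (norm (\<Psi> *v (R *v x)))\<^sup>2"
proof -
  define w where "w = R *v x"
  have "matA R K \<theta> \<Psi> *v x = transpose R *v ((- (\<theta> *\<^sub>R (transpose \<Psi> ** \<Psi>)) + transpose K ** \<Psi>
      + transpose \<Psi> ** K) *v w)"
    by (simp only: matA_def w_def matrix_vector_mul_assoc matrix_mul_assoc)
  then have "x \<bullet> (matA R K \<theta> \<Psi> *v x) = w \<bullet> (- (\<theta> *\<^sub>R (transpose \<Psi> *v (\<Psi> *v w)))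
      + transpose K *v (\<Psi> *v w) + transpose \<Psi> *v (K *v w))"
    by (simp only: inner_matrix_transpose w_def[symmetric] matrix_vector_mult_add_rdistrib
        uminus_matrix_vector scaleR_matrix_vector_assoc[symmetric] matrix_vector_mul_assoc[symmetric])
  also have "\<dots> = 2 * ((K *v w) \<bullet> (\<Psi> *v w)) - \<theta> * (norm (\<Psi> *v w))\<^sup>2"
    by (simp only: inner_add_right inner_minus_right inner_scaleR_right inner_matrix_transpose power2_norm_eq_inner)
      (simp add: inner_commute)
  finally show ?thesis by (simp only: w_def)
qed

text \<open>Summing over coordinate vectors turns identities between quadratic forms into identities
  between traces.\<close>

lemma trace_eq_sum_inner: "trace M = (\<Sum>i\<in>UNIV. axis i 1 \<bullet> (M *v axis i 1))" for M :: "real ^ 'n ^ 'n"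
  by (simp add: trace_def inner_axis' matrix_vector_mult_basis column_def)

lemma norm_matrix_mult_sq: "(norm (\<Psi> ** R))\<^sup>2 = (\<Sum>i\<in>UNIV. (norm (\<Psi> *v (R *v axis i 1)))\<^sup>2)"
  for \<Psi> :: "real ^ 'n ^ 'p" and R :: "real ^ 'k ^ 'n"
  unfolding norm_matrix_sq trace_eq_sum_inner
  by (simp only: matrix_vector_mul_assoc[symmetric] inner_matrix_transpose power2_norm_eq_inner)

lemma trace_conj: "trace (transpose R ** transpose K ** \<Psi> ** R)
    = (\<Sum>i\<in>UNIV. (K *v (R *v axis i 1)) \<bullet> (\<Psi> *v (R *v axis i 1)))"
  for K \<Psi> :: "real ^ 'n ^ 'p" and R :: "real ^ 'k ^ 'n"
  unfolding trace_eq_sum_inner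
  by (simp only: matrix_vector_mul_assoc[symmetric] inner_matrix_transpose)

text \<open>The right side is the beginning of \<open>Qterm\<close>, which is thereby recognized as
  the mean of the quadratic form in the noise.\<close>

lemma trace_matA: "trace (matA R K \<theta> \<Psi>)
    = 2 * trace (transpose R ** transpose K ** \<Psi> ** R) - \<theta> * (norm (\<Psi> ** R))\<^sup>2"
  unfolding trace_eq_sum_inner[of "matA R K \<theta> \<Psi>"] matA_quadratic_form trace_conj norm_matrix_mult_sq
  by (simp only: sum_subtractf sum_distrib_left)

lemma matB_eq_gram: "matB R K \<theta> \<Psi> = ((\<theta> *\<^sub>R \<Psi> - K) ** R) ** transpose ((\<theta> *\<^sub>R \<Psi> - K) ** R)"
  by (simp only: matB_def matrix_transpose_mul matrix_mul_assoc)

lemma Crit_eq: "Crit K \<Psi> pen y m = (norm (\<Psi> m *v y))\<^sup>2 - 2 * ((K *v y) \<bullet> (\<Psi> m *v y)) + pen m"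
  unfolding Crit_def
  by (simp only: matrix_vector_mult_diff_rdistrib scaleR_matrix_vector_assoc[symmetric]
      matrix_vector_mul_assoc[symmetric] inner_diff_right inner_scaleR_right inner_matrix_transpose
      power2_norm_eq_inner)

text \<open>The error splits into the bias \<open>g = \<Psi> *v f - \<beta>\<close> and the noise
  \<open>\<Psi> *v w\<close> with \<open>w = R *v z\<close>. The cross terms \<open>2 * (g \<bullet>
  (K *v w)) - 2 * \<theta> * (g \<bullet> (\<Psi> *v w))\<close> merge into one linear form in
  \<open>z\<close>, whose coefficient vector is controlled by the largest singular value of
  \<open>matB\<close>.\<close>

lemma noise_chaos_eq:
  fixes f :: "real ^ 'n" and K \<Psi> :: "real ^ 'n ^ 'p" and R :: "real ^ 'k ^ 'n"
  assumes \<beta>: "\<beta> = K *v f" and y: "y = f + R *v z"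
  shows "2 * ((K *v (R *v z)) \<bullet> (\<Psi> *v y - \<beta>)) - \<theta> * (norm (\<Psi> *v y - \<beta>))\<^sup>2
    = 2 * ((K *v (R *v z)) \<bullet> (\<Psi> *v (R *v z))) - \<theta> * (norm (\<Psi> *v (R *v z)))\<^sup>2
      - 2 * ((transpose ((\<theta> *\<^sub>R \<Psi> - K) ** R) *v (\<Psi> *v f - \<beta>)) \<bullet> z) - \<theta> * (norm (\<Psi> *v f - \<beta>))\<^sup>2"
proof -
  define w where "w = R *v z"
  define g where "g = \<Psi> *v f - \<beta>"
  have e: "\<Psi> *v y - \<beta> = g + \<Psi> *v w"
    by (simp add: y g_def w_def matrix_vector_right_distrib)
  have b: "(transpose ((\<theta> *\<^sub>R \<Psi> - K) ** R) *v g) \<bullet> z = g \<bullet> (\<theta> *\<^sub>R (\<Psi> *v w) - K *v w)"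
    by (simp only: inner_transpose_matrix_vector matrix_vector_mul_assoc[symmetric] w_def[symmetric]
        matrix_vector_mult_diff_rdistrib scaleR_matrix_vector_assoc[symmetric])
  show ?thesis
    unfolding e g_def[symmetric] b w_def[symmetric]
    by (simp add: power2_norm_eq_inner inner_add inner_diff_right inner_commute algebra_simps)
qed

lemma norm_sum_sq: "(norm (x + y))\<^sup>2 = (norm x)\<^sup>2 + 2 * (x \<bullet> y) + (norm y)\<^sup>2" for x y :: "'b::real_inner"
  by (simp add: power2_norm_eq_inner inner_add inner_commute)

text \<open>Used with \<open>t = 0\<close> for the squared loss and with \<open>t = 2\<close> for
  the part of the criterion that depends on the error. The linear term has mean zero, so only the
  bias and two traces survive integration.\<close>

lemma
  fixes z :: "'a \<Rightarrow> real ^ 'k" and f :: "real ^ 'n" and K \<Psi> :: "real ^ 'n ^ 'p" and R :: "real ^ 'k ^ 'n"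
  assumes P: "prob_space P" and z: "iid_std_normal P z"
    and y: "\<And>\<omega>. \<omega> \<in> space P \<Longrightarrow> y \<omega> = f + R *v z \<omega>"
  shows integrable_loss: "integrable P (\<lambda>\<omega>. (norm (\<Psi> *v y \<omega> - \<beta>))\<^sup>2 - t * ((K *v (R *v z \<omega>)) \<bullet> (\<Psi> *v y \<omega> - \<beta>)))"
    and integral_loss: "(\<integral>\<omega>. (norm (\<Psi> *v y \<omega> - \<beta>))\<^sup>2 - t * ((K *v (R *v z \<omega>)) \<bullet> (\<Psi> *v y \<omega> - \<beta>)) \<partial>P)
      = (norm (\<Psi> *v f - \<beta>))\<^sup>2 + (norm (\<Psi> ** R))\<^sup>2 - t * trace (transpose R ** transpose K ** \<Psi> ** R)"
proof -
  interpret prob_space P by (rule P)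
  define g where "g = \<Psi> *v f - \<beta>"
  define c where "c = transpose (\<Psi> ** R) *v (2 *\<^sub>R g) - transpose (K ** R) *v (t *\<^sub>R g)"
  define N1 where "N1 = transpose (\<Psi> ** R) ** (\<Psi> ** R)"
  define N2 where "N2 = transpose R ** transpose K ** \<Psi> ** R"
  have eq: "(norm (\<Psi> *v y \<omega> - \<beta>))\<^sup>2 - t * ((K *v (R *v z \<omega>)) \<bullet> (\<Psi> *v y \<omega> - \<beta>))
      = (norm g)\<^sup>2 + c \<bullet> z \<omega> + z \<omega> \<bullet> (N1 *v z \<omega>) - t * (z \<omega> \<bullet> (N2 *v z \<omega>))"
    if "\<omega> \<in> space P" for \<omega>
  proof -
    define w where "w = R *v z \<omega>"
    have e: "\<Psi> *v y \<omega> - \<beta> = g + \<Psi> *v w"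
      by (simp add: y[OF that] g_def w_def matrix_vector_right_distrib)
    have n1: "z \<omega> \<bullet> (N1 *v z \<omega>) = (norm (\<Psi> *v w))\<^sup>2"
      by (simp only: N1_def w_def matrix_vector_mul_assoc[symmetric] inner_matrix_transpose power2_norm_eq_inner)
    have n2: "z \<omega> \<bullet> (N2 *v z \<omega>) = (K *v w) \<bullet> (\<Psi> *v w)"
      by (simp only: N2_def w_def matrix_vector_mul_assoc[symmetric] inner_matrix_transpose)
    have c: "c \<bullet> z \<omega> = 2 * (g \<bullet> (\<Psi> *v w)) - t * (g \<bullet> (K *v w))"
      by (simp only: c_def inner_diff_left inner_transpose_matrix_vector matrix_vector_mul_assoc[symmetric]
          w_def inner_scaleR_left)
    show ?thesis
      unfolding e n1 n2 c w_def[symmetric] norm_sum_sq inner_add_right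
      by (simp add: inner_commute algebra_simps)
  qed
  note ints = integrable_inner_std_normal[OF P z] integrable_quadratic_std_normal[OF P z]
  show "integrable P (\<lambda>\<omega>. (norm (\<Psi> *v y \<omega> - \<beta>))\<^sup>2 - t * ((K *v (R *v z \<omega>)) \<bullet> (\<Psi> *v y \<omega> - \<beta>)))"
    by (subst Bochner_Integration.integrable_cong[OF refl eq]) (assumption, intro Bochner_Integration.integrable_add
        Bochner_Integration.integrable_diff integrable_const integrable_mult_right ints)
  have "(\<integral>\<omega>. (norm (\<Psi> *v y \<omega> - \<beta>))\<^sup>2 - t * ((K *v (R *v z \<omega>)) \<bullet> (\<Psi> *v y \<omega> - \<beta>)) \<partial>P)
      = (norm g)\<^sup>2 + trace N1 - t * trace N2"
    by (subst Bochner_Integration.integral_cong[OF refl eq])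
      (auto simp: ints integral_inner_std_normal[OF P z] integral_quadratic_std_normal[OF P z] prob_space)
  then show "(\<integral>\<omega>. (norm (\<Psi> *v y \<omega> - \<beta>))\<^sup>2 - t * ((K *v (R *v z \<omega>)) \<bullet> (\<Psi> *v y \<omega> - \<beta>)) \<partial>P)
      = (norm (\<Psi> *v f - \<beta>))\<^sup>2 + (norm (\<Psi> ** R))\<^sup>2 - t * trace (transpose R ** transpose K ** \<Psi> ** R)"
    by (simp only: N1_def N2_def g_def norm_matrix_sq)
qed

section \<open>Risk bound for the minimizer of the criterion\<close>

theorem theorem1:
  fixes P :: "'a measure"
    and \<beta> :: "real ^ 'p"
    and X :: "real ^ 'p ^ 'n"
    and R :: "real ^ 'n ^ 'n"
    and z y :: "'a \<Rightarrow> real ^ 'n"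
    and M :: "'m set"
    and \<Psi> :: "'m \<Rightarrow> real ^ 'n ^ 'p"
    and K :: "real ^ 'n ^ 'p"
    and L h pen :: "'m \<Rightarrow> real"
    and \<theta> lam :: real
    and mt :: "'a \<Rightarrow> 'm"
  assumes "prob_space P"
    and "iid_std_normal P z"
    and "\<And>\<omega>. \<omega> \<in> space P \<Longrightarrow> y \<omega> = X *v \<beta> + R *v z \<omega>"
    and "finite M" and "M \<noteq> {}"
    and "\<beta> = K *v (X *v \<beta>)"
    and "0 < \<theta>" and "\<theta> < 1"
    and "\<And>m. m \<in> M \<Longrightarrow> 0 < L m"
    and "\<And>m. m \<in> M \<Longrightarrow> 0 < h m"
    and "0 < lam"
    and "mt \<in> measurable P (count_space M)"
    and "\<And>\<omega>. \<omega> \<in> space P \<Longrightarrow> is_arg_min (Crit K \<Psi> pen (y \<omega>)) (\<lambda>m. m \<in> M) (mt \<omega>)"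
  shows "integrable P (\<lambda>\<omega>. (norm (\<Psi> (mt \<omega>) *v y \<omega> - \<beta>))\<^sup>2) \<and>
    (1 - \<theta>) * (\<integral>\<omega>. (norm (\<Psi> (mt \<omega>) *v y \<omega> - \<beta>))\<^sup>2 \<partial>P)
      \<le> (INF m\<in>M. (norm \<beta>)\<^sup>2
              + \<beta> \<bullet> ((transpose X ** transpose (\<Psi> m) ** \<Psi> m ** X) *v \<beta>)
              - 2 * (\<beta> \<bullet> ((\<Psi> m ** X) *v \<beta>))
              + (norm (\<Psi> m ** R))\<^sup>2
              - 2 * trace (transpose R ** transpose K ** \<Psi> m ** R)
              + pen m)
        + (SUP m\<in>M. Qterm R K \<theta> lam (\<Psi> m) (L m) (h m) - pen m)
        + 2 * (\<Sum>m\<in>M. exp (- L m)) / lam"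
proof -
  note P = assms(1) and z = assms(2) and y = assms(3)
  interpret prob_space P by (rule P)
  define f where "f = X *v \<beta>"
  have y_f: "\<And>\<omega>. \<omega> \<in> space P \<Longrightarrow> y \<omega> = f + R *v z \<omega>" using y by (simp add: f_def)
  have \<beta>: "\<beta> = K *v f" using assms(6) by (simp add: f_def)
  define e where "e m \<omega> = \<Psi> m *v y \<omega> - \<beta>" for m \<omega>
  define N where "N \<omega> = K *v (R *v z \<omega>)" for \<omega>
  define Q where "Q m = Qterm R K \<theta> lam (\<Psi> m) (L m) (h m)" for m
  define V where "V m \<omega> = max 0 (2 * (N \<omega> \<bullet> e m \<omega>) - \<theta> * (norm (e m \<omega>))\<^sup>2 - Q m)" for m \<omega>
  define S where "S = (SUP m\<in>M. Q m - pen m)"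
  have mt: "mt \<omega> \<in> M" if "\<omega> \<in> space P" for \<omega>
    using assms(13)[OF that] by (simp add: is_arg_min_def)
  have int_e: "integrable P (\<lambda>\<omega>. (norm (e m \<omega>))\<^sup>2)" for m
    using integrable_loss[OF P z y_f, where t = 0] by (simp add: e_def)
  have int_G: "integrable P (\<lambda>\<omega>. (norm (e m \<omega>))\<^sup>2 - 2 * (N \<omega> \<bullet> e m \<omega>))" for m
    unfolding e_def N_def by (rule integrable_loss[OF P z y_f])
  have int_Ne: "integrable P (\<lambda>\<omega>. 2 * (N \<omega> \<bullet> e m \<omega>))" for m
    using Bochner_Integration.integrable_diff[OF int_e[of m] int_G[of m]] by simp
  have int_V: "integrable P (V m)" for m
  proof -
    have "integrable P (\<lambda>\<omega>. \<theta> * (norm (e m \<omega>))\<^sup>2)" by (rule integrable_mult_right[OF int_e])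
    then have "integrable P (\<lambda>\<omega>. 2 * (N \<omega> \<bullet> e m \<omega>) - \<theta> * (norm (e m \<omega>))\<^sup>2 - Q m)"
      by (intro Bochner_Integration.integrable_diff int_Ne integrable_const)
    then show ?thesis
      unfolding V_def by simp
  qed
  have V_le: "(\<integral>\<omega>. V m \<omega> \<partial>P) \<le> exp (- L m) / lam" if m: "m \<in> M" for m
  proof -
    let ?C = "(\<theta> *\<^sub>R \<Psi> m - K) ** R" and ?g = "\<Psi> m *v f - \<beta>"
    let ?A = "matA R K \<theta> (\<Psi> m)" and ?r = "max_singular_value (matB R K \<theta> (\<Psi> m))"
    have r: "0 \<le> ?r" "(norm (transpose ?C *v ?g))\<^sup>2 \<le> ?r * (norm ?g)\<^sup>2"
      unfolding matB_eq_gram by (rule max_singular_value_gram)+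
    have Q_eq: "Q m = trace ?A + 2 * (?r / \<theta> + max_pos_eigenvalue ?A) * L m + 2 * norm ?A * sqrt (L m + h m)
        + lam * (norm ?A / (sqrt (L m) + sqrt (L m + h m)) + ?r / \<theta> + max_pos_eigenvalue ?A)\<^sup>2"
      by (simp add: Q_def Qterm_def Let_def trace_matA)
    have V_eq: "V m \<omega> = max 0 (z \<omega> \<bullet> (?A *v z \<omega>) - 2 * ((transpose ?C *v ?g) \<bullet> z \<omega>)
        - \<theta> * (norm ?g)\<^sup>2 - Q m)" if "\<omega> \<in> space P" for \<omega>
      unfolding V_def N_def e_def matA_quadratic_form noise_chaos_eq[OF \<beta> y_f[OF that]] ..
    have "ennreal (\<integral>\<omega>. V m \<omega> \<partial>P) = (\<integral>\<^sup>+\<omega>. ennreal (V m \<omega>) \<partial>P)"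
      by (rule nn_integral_eq_integral[symmetric, OF int_V]) (simp add: V_def)
    also have "\<dots> = (\<integral>\<^sup>+\<omega>. ennreal (max 0 (z \<omega> \<bullet> (?A *v z \<omega>) - 2 * ((transpose ?C *v ?g) \<bullet> z \<omega>)
        - \<theta> * (norm ?g)\<^sup>2 - Q m)) \<partial>P)"
      by (intro nn_integral_cong) (simp only: V_eq)
    also have "\<dots> \<le> ennreal (exp (- L m) / lam)"
      unfolding Q_eq using assms(7,9,10,11) m r
      by (intro gaussian_chaos_expected_excess[OF P z transpose_matA]) auto
    finally show ?thesis using assms(11) by (simp add: ennreal_le_iff)
  qed
  have [measurable]: "mt \<in> measurable P (count_space M)" by (rule assms(12))
  \<comment> \<open>The selected index ranges over the finite set \<open>M\<close>, so its loss is
    dominated by a finite sum of integrable losses.\<close>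
  have loss_le: "(norm (e (mt \<omega>) \<omega>))\<^sup>2 \<le> (\<Sum>m\<in>M. (norm (e m \<omega>))\<^sup>2)" if "\<omega> \<in> space P" for \<omega>
    using mt[OF that] assms(4) by (intro member_le_sum) auto
  have loss_meas: "(\<lambda>\<omega>. (norm (e (mt \<omega>) \<omega>))\<^sup>2) \<in> borel_measurable P"
  proof (rule measurable_compose_countable'[where g = mt and I = M])
    show "countable M" using assms(4) by (rule countable_finite)
  qed (use int_e in auto)
  have int_loss: "integrable P (\<lambda>\<omega>. (norm (e (mt \<omega>) \<omega>))\<^sup>2)"
  proof (rule Bochner_Integration.integrable_bound)
    show "integrable P (\<lambda>\<omega>. \<Sum>m\<in>M. (norm (e m \<omega>))\<^sup>2)"
      by (intro Bochner_Integration.integrable_sum int_e)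
    show "AE \<omega> in P. norm ((norm (e (mt \<omega>) \<omega>))\<^sup>2) \<le> norm (\<Sum>m\<in>M. (norm (e m \<omega>))\<^sup>2)"
      using loss_le by (intro AE_I2) (simp add: sum_nonneg)
  qed (rule loss_meas)
  \<comment> \<open>At the selected index the left side is
    \<open>(norm e)\<^sup>2 - 2 * (N \<bullet> e)\<close> plus
    \<open>2 * (N \<bullet> e) - \<theta> * (norm e)\<^sup>2\<close>. Minimality bounds the first
    part together with the penalty, and \<open>Q + V\<close> bounds the second; the leftover
    \<open>Q - pen\<close> is at most \<open>S\<close>.\<close>
  have pointwise: "(1 - \<theta>) * (norm (e (mt \<omega>) \<omega>))\<^sup>2
      \<le> ((norm (e m \<omega>))\<^sup>2 - 2 * (N \<omega> \<bullet> e m \<omega>)) + (pen m + S) + (\<Sum>k\<in>M. V k \<omega>)"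
    if m: "m \<in> M" and \<omega>: "\<omega> \<in> space P" for m \<omega>
  proof -
    have Ky: "K *v y \<omega> = \<beta> + N \<omega>"
      by (simp add: y_f[OF \<omega>] matrix_vector_right_distrib N_def \<beta>[symmetric])
    \<comment> \<open>The last two terms do not depend on \<open>k\<close> and cancel when two
      values of the criterion are compared.\<close>
    have crit: "Crit K \<Psi> pen (y \<omega>) k = (norm (e k \<omega>))\<^sup>2 - 2 * (N \<omega> \<bullet> e k \<omega>) + pen k
        - (norm \<beta>)\<^sup>2 - 2 * (N \<omega> \<bullet> \<beta>)" for k
    proof -
      have \<Psi>y: "\<Psi> k *v y \<omega> = e k \<omega> + \<beta>" by (simp add: e_def)
      show ?thesis
        unfolding Crit_eq Ky \<Psi>y
        by (simp add: power2_norm_eq_inner inner_add inner_commute algebra_simps)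
    qed
    have "Crit K \<Psi> pen (y \<omega>) (mt \<omega>) \<le> Crit K \<Psi> pen (y \<omega>) m"
      using assms(13)[OF \<omega>] m by (auto simp: is_arg_min_def not_less)
    then have "(norm (e (mt \<omega>) \<omega>))\<^sup>2 - 2 * (N \<omega> \<bullet> e (mt \<omega>) \<omega>) + pen (mt \<omega>)
        \<le> (norm (e m \<omega>))\<^sup>2 - 2 * (N \<omega> \<bullet> e m \<omega>) + pen m"
      unfolding crit by simp
    moreover have "2 * (N \<omega> \<bullet> e (mt \<omega>) \<omega>) - \<theta> * (norm (e (mt \<omega>) \<omega>))\<^sup>2 \<le> Q (mt \<omega>) + V (mt \<omega>) \<omega>"
      by (simp add: V_def)
    moreover have "V (mt \<omega>) \<omega> \<le> (\<Sum>k\<in>M. V k \<omega>)"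
      using mt[OF \<omega>] assms(4) by (intro member_le_sum) (auto simp: V_def)
    moreover have "Q (mt \<omega>) - pen (mt \<omega>) \<le> S"
      unfolding S_def using mt[OF \<omega>] assms(4) by (intro cSUP_upper) auto
    ultimately show ?thesis by (simp add: left_diff_distrib)
  qed
  define risk where "risk m = (norm \<beta>)\<^sup>2 + \<beta> \<bullet> ((transpose X ** transpose (\<Psi> m) ** \<Psi> m ** X) *v \<beta>)
      - 2 * (\<beta> \<bullet> ((\<Psi> m ** X) *v \<beta>)) + (norm (\<Psi> m ** R))\<^sup>2
      - 2 * trace (transpose R ** transpose K ** \<Psi> m ** R) + pen m" for m
  \<comment> \<open>The left side does not involve \<open>m\<close>, so the infimum can be taken
    after integrating for each fixed \<open>m\<close>.\<close>
  have bound: "(1 - \<theta>) * (\<integral>\<omega>. (norm (e (mt \<omega>) \<omega>))\<^sup>2 \<partial>P) - S - 2 * (\<Sum>m\<in>M. exp (- L m)) / lam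
      \<le> risk m" if m: "m \<in> M" for m
  proof -
    have "(1 - \<theta>) * (\<integral>\<omega>. (norm (e (mt \<omega>) \<omega>))\<^sup>2 \<partial>P) = (\<integral>\<omega>. (1 - \<theta>) * (norm (e (mt \<omega>) \<omega>))\<^sup>2 \<partial>P)"
      by simp
    also have "\<dots> \<le> (\<integral>\<omega>. ((norm (e m \<omega>))\<^sup>2 - 2 * (N \<omega> \<bullet> e m \<omega>)) + (pen m + S) + (\<Sum>k\<in>M. V k \<omega>) \<partial>P)"
      by (intro integral_mono pointwise[OF m] integrable_mult_right int_loss Bochner_Integration.integrable_add
          integrable_const Bochner_Integration.integrable_sum int_G int_V)
    also have "\<dots> = (\<integral>\<omega>. (norm (e m \<omega>))\<^sup>2 - 2 * (N \<omega> \<bullet> e m \<omega>) \<partial>P) + (pen m + S) + (\<Sum>k\<in>M. \<integral>\<omega>. V k \<omega> \<partial>P)"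
      using int_G int_V by (simp add: prob_space)
    also have "(\<integral>\<omega>. (norm (e m \<omega>))\<^sup>2 - 2 * (N \<omega> \<bullet> e m \<omega>) \<partial>P)
        = (norm (\<Psi> m *v f - \<beta>))\<^sup>2 + (norm (\<Psi> m ** R))\<^sup>2 - 2 * trace (transpose R ** transpose K ** \<Psi> m ** R)"
      unfolding e_def N_def by (rule integral_loss[OF P z y_f])
    also have "(norm (\<Psi> m *v f - \<beta>))\<^sup>2 = (norm \<beta>)\<^sup>2
        + \<beta> \<bullet> ((transpose X ** transpose (\<Psi> m) ** \<Psi> m ** X) *v \<beta>) - 2 * (\<beta> \<bullet> ((\<Psi> m ** X) *v \<beta>))"
    proof -
      have 1: "\<beta> \<bullet> ((transpose X ** transpose (\<Psi> m) ** \<Psi> m ** X) *v \<beta>) = (norm (\<Psi> m *v f))\<^sup>2"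
        by (simp only: matrix_vector_mul_assoc[symmetric] inner_matrix_transpose f_def power2_norm_eq_inner)
      have 2: "(\<Psi> m ** X) *v \<beta> = \<Psi> m *v f" by (simp only: matrix_vector_mul_assoc[symmetric] f_def)
      show ?thesis
        unfolding 1 2 by (simp add: power2_norm_eq_inner inner_diff inner_commute)
    qed
    finally have "(1 - \<theta>) * (\<integral>\<omega>. (norm (e (mt \<omega>) \<omega>))\<^sup>2 \<partial>P) \<le> (norm \<beta>)\<^sup>2
        + \<beta> \<bullet> ((transpose X ** transpose (\<Psi> m) ** \<Psi> m ** X) *v \<beta>) - 2 * (\<beta> \<bullet> ((\<Psi> m ** X) *v \<beta>))
        + (norm (\<Psi> m ** R))\<^sup>2 - 2 * trace (transpose R ** transpose K ** \<Psi> m ** R)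
        + (pen m + S) + (\<Sum>k\<in>M. \<integral>\<omega>. V k \<omega> \<partial>P)" .
    moreover have "(\<Sum>k\<in>M. \<integral>\<omega>. V k \<omega> \<partial>P) \<le> 2 * (\<Sum>m\<in>M. exp (- L m)) / lam"
    proof -
      have "(\<Sum>k\<in>M. \<integral>\<omega>. V k \<omega> \<partial>P) \<le> (\<Sum>k\<in>M. exp (- L k) / lam)" by (intro sum_mono V_le)
      also have "\<dots> = (\<Sum>m\<in>M. exp (- L m)) / lam" by (simp add: sum_divide_distrib)
      also have "\<dots> \<le> 2 * (\<Sum>m\<in>M. exp (- L m)) / lam"
        using assms(11) by (intro divide_right_mono) (auto intro: sum_nonneg)
      finally show ?thesis .
    qed
    ultimately show ?thesis unfolding risk_def by linarith
  qed
  show ?thesis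
  proof (rule conjI)
    show "integrable P (\<lambda>\<omega>. (norm (\<Psi> (mt \<omega>) *v y \<omega> - \<beta>))\<^sup>2)" using int_loss by (simp only: e_def)
    have "(1 - \<theta>) * (\<integral>\<omega>. (norm (e (mt \<omega>) \<omega>))\<^sup>2 \<partial>P) - S - 2 * (\<Sum>m\<in>M. exp (- L m)) / lam
        \<le> (INF m\<in>M. risk m)"
      by (rule cINF_greatest[OF assms(5)]) (rule bound)
    then show "(1 - \<theta>) * (\<integral>\<omega>. (norm (\<Psi> (mt \<omega>) *v y \<omega> - \<beta>))\<^sup>2 \<partial>P)
      \<le> (INF m\<in>M. (norm \<beta>)\<^sup>2
              + \<beta> \<bullet> ((transpose X ** transpose (\<Psi> m) ** \<Psi> m ** X) *v \<beta>)
              - 2 * (\<beta> \<bullet> ((\<Psi> m ** X) *v \<beta>))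
              + (norm (\<Psi> m ** R))\<^sup>2
              - 2 * trace (transpose R ** transpose K ** \<Psi> m ** R)
              + pen m)
        + (SUP m\<in>M. Qterm R K \<theta> lam (\<Psi> m) (L m) (h m) - pen m)
        + 2 * (\<Sum>m\<in>M. exp (- L m)) / lam"
      unfolding risk_def S_def Q_def e_def by linarith
  qed
qed

end
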